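(* Fix $d\ge2$ and $t\ge2$. There exist constants $\varepsilon_0,C>0$, depending only on $d$ and $t$, such that the following holds. Let $\nu$ be a probability measure supported on $[-1,\alpha]$, where $$\eta_{t,d}\le\alpha\le\eta_{t,d}+\varepsilon_0,\qquad\delta:=\alpha-\eta_{t,d},$$ and suppose that $\nu$ and $\mu_d$ have the same moments through degree $t$. Then $$\int\operatorname{dist}(s,\Xi_{t,d})^2\,d\nu(s)\le C\delta\qquad\text{and}\qquad W_1(\nu,\nu^*_{t,d})\le C\sqrt\delta.$$ More precisely, let $\Xi_\alpha=\{\xi_0,\ldots,\xi_{n-1},\alpha\}$ be the set obtained from $\Xi_{t,d}$ by replacing its largest node $\xi_n=\eta_{t,d}$ with $\alpha$, choose a (measurable) nearest-node projection from $[-1,\alpha]$ onto $\Xi_\alpha$, let $E_k(\alpha)$ be its Voronoi cells (for $k<n$ the set of points projected to $\xi_k$; the top cell $E_n(\alpha)$ is the set of points projected to $\alpha$, which corresponds to the node $\xi_n=\eta_{t,d}$), and put $w_k:=\nu(E_k(\alpha))$. Then $$\sum_{k=0}^n|w_k-\lambda_k|\le C\sqrt\delta.$$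
   Context: Let $\mu_d$ be the distribution of the first coordinate of a uniform random point of the unit sphere $\mathbb S^{d-1}\subset\mathbb R^d$, i.e. $d\mu_d(s)=c_d(1-s^2)^{(d-3)/2}ds$ on $[-1,1]$ with $c_d$ normalizing. Let $p_k$ be the degree-$k$ orthogonal polynomial for $\mu_d$, and $p_k^+$ the degree-$k$ orthogonal polynomial for $(1+s)\,d\mu_d(s)$. If $t=2n+1$, $\eta_{t,d}$ is the largest zero of $p_{n+1}$, the nodes $\xi_0<\cdots<\xi_n=\eta_{t,d}$ are the zeros of $p_{n+1}$, and $\lambda_0,\ldots,\lambda_n>0$ are the Gaussian quadrature weights. If $t=2n$, $\eta_{t,d}$ is the largest zero of $p_n^+$, the nodes are $-1=\xi_0<\xi_1<\cdots<\xi_n=\eta_{t,d}$ with $\xi_1,\ldots,\xi_n$ the zeros of $p_n^+$, and $\lambda_0,\ldots,\lambda_n>0$ are the Gauss--Radau weights with prescribed node $-1$. In both cases the weights are the unique ones with $\sum_k\lambda_kq(\xi_k)=\int q\,d\mu_d$ for all polynomials $q$ of degree $\le t$. Put $\Xi_{t,d}=\{\xi_0,\ldots,\xi_n\}$ and $\nu^*_{t,d}=\sum_{k=0}^n\lambda_k\delta_{\xi_k}$. $W_1$ is the Wasserstein distance for probability measures on $[-1,1]$ with cost $|s-r|$. *)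

theory Defs
  imports "HOL-Probability.Probability" "HOL-Computational_Algebra.Polynomial"
begin

definition sphere_marginal_const :: "nat \<Rightarrow> real" where
  "sphere_marginal_const d =
     inverse (LBINT s:{-1..1}. (1 - s\<^sup>2) powr ((real d - 3) / 2))"

definition sphere_marginal :: "nat \<Rightarrow> real measure" where
  "sphere_marginal d = density lborel
     (\<lambda>s. ennreal (sphere_marginal_const d * (1 - s\<^sup>2) powr ((real d - 3) / 2)
                    * indicator {-1..1} s))"

text \<open>Orthogonal polynomials are determined up to a scalar factor only; we take the monic
  representative. Only the zeros are used below.\<close>

definition orth_poly :: "real measure \<Rightarrow> nat \<Rightarrow> real poly" where
  "orth_poly M k = (THE p. degree p = k \<and> lead_coeff p = 1 \<and>
     (\<forall>q. degree q < k \<longrightarrow> (\<integral>s. poly p s * poly q s \<partial>M) = 0))"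

text \<open>With \<open>n = t div 2\<close>, these are the zeros of \<open>p\<^sub>n\<^sub>+\<^sub>1\<close> for \<open>t = 2 n + 1\<close>, and those of the
  polynomial of degree \<open>n\<close> orthogonal for the weight \<open>1 + s\<close> for \<open>t = 2 n\<close>.\<close>

definition quad_zeros :: "nat \<Rightarrow> nat \<Rightarrow> real set" where
  "quad_zeros t d =
     (if odd t
      then {x. poly (orth_poly (sphere_marginal d) (t div 2 + 1)) x = 0}
      else {x. poly (orth_poly (density (sphere_marginal d) (\<lambda>s. ennreal (1 + s))) (t div 2)) x = 0})"

definition eta :: "nat \<Rightarrow> nat \<Rightarrow> real" where
  "eta t d = Max (quad_zeros t d)"

definition node_set :: "nat \<Rightarrow> nat \<Rightarrow> real set" where
  "node_set t d = (if odd t then quad_zeros t d else insert (- 1) (quad_zeros t d))"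

text \<open>The nodes in increasing order, indexed by \<open>0, \<dots>, t div 2\<close>.\<close>

definition node :: "nat \<Rightarrow> nat \<Rightarrow> nat \<Rightarrow> real" where
  "node t d k = sorted_list_of_set (node_set t d) ! k"

text \<open>The value \<open>0\<close> beyond the last index is a convention that makes the weight function unique.\<close>

definition quad_weight :: "nat \<Rightarrow> nat \<Rightarrow> nat \<Rightarrow> real" where
  "quad_weight t d = (THE l. (\<forall>k>t div 2. l k = 0) \<and>
     (\<forall>q. degree q \<le> t \<longrightarrow>
        (\<Sum>k\<le>t div 2. l k * poly q (node t d k)) = (\<integral>s. poly q s \<partial>sphere_marginal d)))"

text \<open>The discrete measure with mass \<open>quad_weight t d k\<close> at \<open>node t d k\<close>, as a push-forward.\<close>

definition quad_measure :: "nat \<Rightarrow> nat \<Rightarrow> real measure" where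
  "quad_measure t d =
     distr (point_measure {..t div 2} (\<lambda>k. ennreal (quad_weight t d k))) borel (node t d)"

definition couplings :: "real measure \<Rightarrow> real measure \<Rightarrow> (real \<times> real) measure set" where
  "couplings M N = {G. sets G = sets (borel \<Otimes>\<^sub>M borel) \<and>
     distr G borel fst = M \<and> distr G borel snd = N}"

text \<open>Measures on an interval are represented as Borel measures on the real line that are
  concentrated on it; couplings of such measures are concentrated on the product.\<close>

definition wasserstein1 :: "real measure \<Rightarrow> real measure \<Rightarrow> ennreal" where
  "wasserstein1 M N = (INF G \<in> couplings M N. \<integral>\<^sup>+ (s, r). ennreal \<bar>s - r\<bar> \<partial>G)"

definition nearest_projection :: "real set \<Rightarrow> real set \<Rightarrow> (real \<Rightarrow> real) \<Rightarrow> bool" where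
  "nearest_projection A S \<pi> \<longleftrightarrow>
     \<pi> \<in> borel_measurable (restrict_space borel A) \<and>
     (\<forall>s\<in>A. \<pi> s \<in> S \<and> dist s (\<pi> s) = infdist s S)"

definition moved_node :: "nat \<Rightarrow> nat \<Rightarrow> real \<Rightarrow> nat \<Rightarrow> real" where
  "moved_node t d \<alpha> = (node t d)(t div 2 := \<alpha>)"

definition moved_node_set :: "nat \<Rightarrow> nat \<Rightarrow> real \<Rightarrow> real set" where
  "moved_node_set t d \<alpha> = moved_node t d \<alpha> ` {..t div 2}"

definition voronoi_cell :: "nat \<Rightarrow> nat \<Rightarrow> real \<Rightarrow> (real \<Rightarrow> real) \<Rightarrow> nat \<Rightarrow> real set" where
  "voronoi_cell t d \<alpha> \<pi> k = {s \<in> {-1..\<alpha>}. \<pi> s = moved_node t d \<alpha> k}"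

end

theory Submission
  imports Defs
begin

text \<open>Let \<open>\<xi>\<^sub>0 < \<dots> < \<xi>\<^sub>n = \<eta>\<close> be the nodes. There is a polynomial \<open>h\<close> of degree below \<open>t\<close>,
  nonnegative on the support, that vanishes at every node except the largest, to second order away
  from \<open>-1\<close>. The product \<open>h s * (s - \<eta>)\<close> has degree at most \<open>t\<close> and vanishes at all nodes, so by the
  quadrature formula and the moment condition its \<open>\<nu>\<close>-integral is zero. Its positive part is
  \<open>O(\<delta>)\<close> on \<open>[-1, \<alpha>]\<close>, hence so is the integral of its absolute value, which dominates the squared
  distance to the node set. Cauchy-Schwarz then gives \<open>O(\<surd>\<delta>)\<close> for the first moment of that
  distance. Cell masses are compared with the quadrature weights by integrating the Lagrange basis
  polynomials, which are Lipschitz and have the weights as their integrals; small errors in the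
  masses cost little to transport.\<close>

section \<open>Orthogonal polynomials and their zeros\<close>

text \<open>The shape of the estimate comes from a degree count. The top node gets a simple factor,
  because the sign change at \<eta> is what allows the integral to vanish; quadratic factors at the
  n lower nodes then bring the degree to 2 n + 1, which is exactly t in the odd case. For t = 2 n
  one degree is missing, and the prescribed node at the end of the support saves it. The price of
  the simple factor is the part of the support above \<eta>, hence the rate \<delta>. Projecting to
  the nearest node does not yet give a coupling with the quadrature measure, since the cell masses
  only approximate the weights. The correction must stay nonnegative, which takes strictly positive
  weights and small \<delta>. This is one source of \<epsilon>0; the other only keeps all supports
  inside [-1, 2]. The zeros are studied for a general measure because two are needed, the sphere
  marginal and its multiple by 1 + s. Orthogonal polynomials and weights are definite descriptions,
  so existence and uniqueness must be shown before they can be used.\<close>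

locale poly_moments =
  fixes M :: "real measure"
  assumes integrable_poly: "integrable M (poly p)"
    and integral_poly_pos:
      "p \<noteq> 0 \<Longrightarrow> (\<And>s. -1 \<le> s \<Longrightarrow> s \<le> 1 \<Longrightarrow> 0 \<le> poly p s) \<Longrightarrow> 0 < (\<integral>s. poly p s \<partial>M)"
begin

lemma integrable_poly_mult: "integrable M (\<lambda>s. poly p s * poly q s)"
  using integrable_poly[of "p * q"] by (simp add: fun_eq_iff cong: Bochner_Integration.integrable_cong)

text \<open>The bound is kept apart from the degree: the node polynomial of a Radau rule has degree
  n + 1, but its orthogonality is used only against degrees below n.\<close>

definition orthogonal_below :: "real poly \<Rightarrow> nat \<Rightarrow> bool" where
  "orthogonal_below p m \<longleftrightarrow> (\<forall>q. degree q < m \<longrightarrow> (\<integral>s. poly p s * poly q s \<partial>M) = 0)"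

lemma integral_square_pos: "p \<noteq> 0 \<Longrightarrow> 0 < (\<integral>s. poly p s * poly p s \<partial>M)"
  using integral_poly_pos[of "p * p"] by simp

text \<open>Gram-Schmidt, arranged as an induction on the orthogonality bound for all degrees
  \<open>k\<close> at once: the hypothesis then supplies both the polynomial to be corrected and the
  degree-\<open>m\<close> polynomial \<open>e\<close> that corrects it.\<close>

lemma exists_orthogonal:
  "m \<le> k \<Longrightarrow> \<exists>p. degree p = k \<and> lead_coeff p = 1 \<and> orthogonal_below p m"
proof (induction m arbitrary: k)
  case 0
  show ?case
    by (rule exI[of _ "monom 1 k"]) (simp add: degree_monom_eq orthogonal_below_def)
next
  case (Suc m)
  obtain p where p: "degree p = k" "lead_coeff p = 1" "orthogonal_below p m"
    using Suc.IH[of k] Suc.prems by auto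
  obtain e where e: "degree e = m" "lead_coeff e = 1" "orthogonal_below e m"
    using Suc.IH[of m] by auto
  have e0: "e \<noteq> 0" using e(2) by auto
  define c where "c = (\<integral>s. poly p s * poly e s \<partial>M) / (\<integral>s. poly e s * poly e s \<partial>M)"
  define r where "r = p - smult c e"
  have "degree (smult c e) < degree p"
    using e(1) p(1) Suc.prems by (simp add: degree_smult_eq)
  then have r1: "degree r = k" "lead_coeff r = 1"
    using p(1,2) degree_add_eq_left[of "- smult c e" p] unfolding r_def
    by (auto simp: coeff_eq_0 e(1) split: if_splits)
  have int_r: "(\<integral>s. poly r s * poly q s \<partial>M)
      = (\<integral>s. poly p s * poly q s \<partial>M) - c * (\<integral>s. poly e s * poly q s \<partial>M)" for q
  proof -
    have "(\<integral>s. poly r s * poly q s \<partial>M)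
        = (\<integral>s. poly p s * poly q s - c * (poly e s * poly q s) \<partial>M)"
      by (simp add: r_def algebra_simps)
    then show ?thesis
      using integrable_poly_mult by simp
  qed
  have re: "(\<integral>s. poly r s * poly e s \<partial>M) = 0"
    unfolding int_r c_def using integral_square_pos[OF e0] by simp
  have "orthogonal_below r (Suc m)"
    unfolding orthogonal_below_def
  proof (intro allI impI)
    fix q :: "real poly" assume q: "degree q < Suc m"
    define a where "a = coeff q m"
    define u where "u = q - smult a e"
    \<comment> \<open>The zero polynomial has degree 0, so it needs its own case when
      \<open>m\<close> is 0.\<close>
    have "u = 0 \<or> degree u < m"
    proof (cases "u = 0")
      case False
      have "degree u \<le> m"
        unfolding u_def using q e(1)
        by (intro degree_diff_le) (auto intro: order.trans[OF degree_smult_le])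
      moreover have "coeff u m = 0"
        unfolding u_def a_def using e(1,2) by simp
      ultimately show ?thesis
        using False by (metis le_neq_implies_less leading_coeff_0_iff)
    qed simp
    then have "(\<integral>s. poly r s * poly u s \<partial>M) = 0"
    proof
      assume "degree u < m"
      then show ?thesis
        unfolding int_r using p(3) e(3) by (simp add: orthogonal_below_def)
    qed simp
    moreover have "(\<integral>s. poly r s * poly q s \<partial>M)
        = (\<integral>s. poly r s * poly u s + a * (poly r s * poly e s) \<partial>M)"
      by (simp add: u_def algebra_simps)
    ultimately show "(\<integral>s. poly r s * poly q s \<partial>M) = 0"
      using integrable_poly_mult re by simp
  qed
  then show ?case using r1 by blast
qed

text \<open>Makes the definite description usable. Two monic candidates differ by a polynomial of
  smaller degree, which is then orthogonal to itself.\<close>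

lemma orth_poly:
  shows degree_orth_poly: "degree (orth_poly M k) = k"
    and lead_coeff_orth_poly: "lead_coeff (orth_poly M k) = 1"
    and orthogonal_orth_poly: "orthogonal_below (orth_poly M k) k"
proof -
  have "\<exists>!p. degree p = k \<and> lead_coeff p = 1 \<and>
     (\<forall>q. degree q < k \<longrightarrow> (\<integral>s. poly p s * poly q s \<partial>M) = 0)"
  proof (rule ex_ex1I)
    show "\<exists>p. degree p = k \<and> lead_coeff p = 1 \<and>
     (\<forall>q. degree q < k \<longrightarrow> (\<integral>s. poly p s * poly q s \<partial>M) = 0)"
      using exists_orthogonal[of k k] by (simp add: orthogonal_below_def)
  next
    fix p q :: "real poly"
    assume p: "degree p = k \<and> lead_coeff p = 1 \<and>
       (\<forall>q. degree q < k \<longrightarrow> (\<integral>s. poly p s * poly q s \<partial>M) = 0)"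
      and q: "degree q = k \<and> lead_coeff q = 1 \<and>
       (\<forall>r. degree r < k \<longrightarrow> (\<integral>s. poly q s * poly r s \<partial>M) = 0)"
    show "p = q"
    proof (rule ccontr)
      assume ne: "p \<noteq> q"
      define r where "r = p - q"
      have "degree r \<le> k"
        unfolding r_def using p q by (intro degree_diff_le) auto
      moreover have "coeff r k = 0" using p q by (auto simp: r_def)
      moreover have "r \<noteq> 0" using ne by (simp add: r_def)
      ultimately have "degree r < k"
        by (metis le_neq_implies_less leading_coeff_0_iff)
      then have "(\<integral>s. poly p s * poly r s - poly q s * poly r s \<partial>M) = 0"
        using p q integrable_poly_mult by simp
      then have "(\<integral>s. poly r s * poly r s \<partial>M) = 0"
        by (simp add: r_def algebra_simps)
      then show False using integral_square_pos[OF \<open>r \<noteq> 0\<close>] by simp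
    qed
  qed
  then have *: "degree (orth_poly M k) = k \<and> lead_coeff (orth_poly M k) = 1 \<and>
     (\<forall>q. degree q < k \<longrightarrow> (\<integral>s. poly (orth_poly M k) s * poly q s \<partial>M) = 0)"
    unfolding orth_poly_def by (rule theI')
  show "degree (orth_poly M k) = k" "lead_coeff (orth_poly M k) = 1"
       "orthogonal_below (orth_poly M k) k"
    using * unfolding orthogonal_below_def by blast+
qed

text \<open>The cofactor \<open>b\<close> has degree below \<open>k\<close>, so \<open>p\<close> is
  orthogonal to it; but the product of \<open>p\<close> and \<open>b\<close> is
  \<open>a * (b * b)\<close>, which keeps one sign on the interval.\<close>

lemma orthogonal_no_definite_factor:
  assumes p: "degree p = k" "p \<noteq> 0" "orthogonal_below p k"
    and ab: "p = a * b" and a: "degree a > 0"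
    and sgn: "(\<forall>s. -1 \<le> s \<and> s \<le> 1 \<longrightarrow> 0 \<le> poly a s) \<or> (\<forall>s. -1 \<le> s \<and> s \<le> 1 \<longrightarrow> poly a s \<le> 0)"
  shows False
proof -
  have nz: "a \<noteq> 0" "b \<noteq> 0" using p(2) ab by auto
  have "degree b < k" using p(1) ab a nz by (simp add: degree_mult_eq)
  then have "(\<integral>s. poly p s * poly b s \<partial>M) = 0"
    using p(3) by (simp add: orthogonal_below_def)
  then have 0: "(\<integral>s. poly (a * (b * b)) s \<partial>M) = 0"
    by (simp add: ab algebra_simps)
  show False using sgn
  proof
    assume "\<forall>s. -1 \<le> s \<and> s \<le> 1 \<longrightarrow> 0 \<le> poly a s"
    then show False
      using integral_poly_pos[of "a * (b * b)"] nz 0 by simp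
  next
    assume "\<forall>s. -1 \<le> s \<and> s \<le> 1 \<longrightarrow> poly a s \<le> 0"
    then have "\<forall>s. -1 \<le> s \<and> s \<le> 1 \<longrightarrow> 0 \<le> poly (- a * (b * b)) s"
      by (simp add: mult_nonpos_nonneg)
    moreover have "- a * (b * b) \<noteq> 0" using nz by simp
    ultimately have "0 < (\<integral>s. poly (- a * (b * b)) s \<partial>M)"
      using integral_poly_pos[of "- a * (b * b)"] by blast
    then show False using 0 by simp
  qed
qed

end

section \<open>Signs and linear factors of real polynomials\<close>

lemma poly_rootless_definite:
  fixes b :: "real poly"
  assumes "\<And>z. poly b z \<noteq> 0"
  shows "(\<forall>s. 0 \<le> poly b s) \<or> (\<forall>s. poly b s \<le> 0)"
proof (rule ccontr)
  assume "\<not> ?thesis"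
  then obtain u v where uv: "poly b u < 0" "0 < poly b v" by (auto simp: not_le)
  have "u \<noteq> v" using uv by auto
  then consider "u < v" | "v < u" by linarith
  then show False
    using uv poly_IVT_pos[of u v b] poly_IVT_neg[of v u b] assms by cases blast+
qed

lemma prod_linear_dvd:
  fixes p :: "real poly"
  assumes "finite Z" "\<And>z. z \<in> Z \<Longrightarrow> poly p z = 0"
  shows "(\<Prod>z\<in>Z. [:-z, 1:]) dvd p"
  using assms
proof (induction Z arbitrary: p rule: finite_induct)
  case (insert z Z)
  then obtain b where b: "p = [:-z, 1:] * b"
    by (meson dvdE insertI1 poly_eq_0_iff_dvd)
  have "poly b y = 0" if "y \<in> Z" for y
    using insert.prems[of y] insert.hyps that by (auto simp: b)
  then have "(\<Prod>z\<in>Z. [:-z, 1:]) dvd b" by (rule insert.IH)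
  then show ?case
    unfolding b prod.insert[OF insert.hyps] by (rule mult_dvd_mono[OF dvd_refl])
qed simp

lemma degree_prod_linear: "degree (\<Prod>z\<in>Z. [:- f z, 1::real:]) = card Z"
  by (subst degree_prod_eq_sum_degree) simp_all

context poly_moments
begin

text \<open>No factor of an orthogonal polynomial has constant sign on the interval. This rules out zeros
  outside the interval, double zeros, and a rootless factor.\<close>

lemma orthogonal_zeros:
  assumes p: "degree p = k" "lead_coeff p = 1" "orthogonal_below p k"
  defines "Z \<equiv> {z. poly p z = 0}"
  shows "finite Z" "card Z = k" "Z \<subseteq> {-1<..<1}" "p = (\<Prod>z\<in>Z. [:-z, 1:])"
proof -
  have p0: "p \<noteq> 0" using p(2) by auto
  show fin: "finite Z" unfolding Z_def using p0 by (rule poly_roots_finite)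
  note nf = orthogonal_no_definite_factor[OF p(1) p0 p(3)]
  show sub: "Z \<subseteq> {-1<..<1}"
  proof
    fix z assume "z \<in> Z"
    then obtain b where "p = [:-z, 1:] * b"
      unfolding Z_def by (metis dvdE mem_Collect_eq poly_eq_0_iff_dvd)
    then have "\<not> (1 \<le> z \<or> z \<le> -1)"
      using nf[of "[:-z, 1:]" b] by auto
    then show "z \<in> {-1<..<1}" by auto
  qed
  define q where "q = (\<Prod>z\<in>Z. [:-z, 1:])"
  obtain b where b: "p = q * b"
    using prod_linear_dvd[OF fin, of p] unfolding Z_def q_def by (auto elim: dvdE)
  have "poly b z \<noteq> 0" for z
  proof
    assume z: "poly b z = 0"
    then have "z \<in> Z" by (simp add: Z_def b)
    then obtain u where u: "q = [:-z, 1:] * u"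
      unfolding q_def using fin by (metis dvdE dvd_prodI)
    obtain v where v: "b = [:-z, 1:] * v" using z by (metis dvdE poly_eq_0_iff_dvd)
    then have "p = ([:-z, 1:] * [:-z, 1:]) * (u * v)"
      unfolding b u v by (simp only: mult_ac)
    moreover have "0 \<le> poly ([:-z, 1:] * [:-z, 1:]) s" for s
      unfolding poly_mult by (rule zero_le_square)
    moreover have "degree ([:-z, 1:] * [:-z, 1:]) = 2"
      by (simp add: degree_mult_eq del: mult_pCons_left)
    ultimately show False
      using nf[of "[:-z, 1:] * [:-z, 1:]" "u * v"] by auto
  qed
  then have def: "(\<forall>s. 0 \<le> poly b s) \<or> (\<forall>s. poly b s \<le> 0)"
    by (rule poly_rootless_definite)
  have "degree b = 0"
  proof (rule ccontr)
    assume "degree b \<noteq> 0"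
    then show False using nf[of b q] b def by (auto simp: mult.commute)
  qed
  then obtain c where c: "b = [:c:]" by (metis degree_eq_zeroE)
  have q1: "lead_coeff q = 1" unfolding q_def by (simp add: lead_coeff_prod)
  have "lead_coeff p = lead_coeff q * lead_coeff b" by (simp add: b lead_coeff_mult)
  then have "c = 1" using q1 p(2) c by simp
  then have pq: "p = q" using b c by simp
  then show "p = (\<Prod>z\<in>Z. [:-z, 1:])" by (simp add: q_def)
  show "card Z = k"
    using p(1) degree_prod_linear[of "\<lambda>z. z" Z] pq by (simp add: q_def)
qed

end

section \<open>Nodes, Lagrange basis and couplings\<close>

lemma poly_lipschitz_on_interval:
  fixes p :: "real poly"
  shows "\<exists>K. \<forall>u\<in>{a..b}. \<forall>v\<in>{a..b}. \<bar>poly p u - poly p v\<bar> \<le> K * \<bar>u - v\<bar>"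
proof -
  have "bounded ((\<lambda>s. poly (pderiv p) s) ` {a..b})"
    by (intro compact_imp_bounded compact_continuous_image continuous_intros) simp
  then obtain K where K: "\<And>s. s \<in> {a..b} \<Longrightarrow> \<bar>poly (pderiv p) s\<bar> \<le> K"
    unfolding bounded_iff by (auto simp del: atLeastAtMost_iff)
  have "norm (poly p u - poly p v) \<le> K * norm (u - v)" if "u \<in> {a..b}" "v \<in> {a..b}" for u v
    by (rule field_differentiable_bound[where S = "{a..b}" and f' = "poly (pderiv p)"])
      (use that K in \<open>auto intro!: poly_DERIV DERIV_subset[OF poly_DERIV]\<close>)
  then have "\<forall>u\<in>{a..b}. \<forall>v\<in>{a..b}. \<bar>poly p u - poly p v\<bar> \<le> K * \<bar>u - v\<bar>"
    by (simp del: atLeastAtMost_iff)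
  then show ?thesis ..
qed

lemma integrable_continuous_on_bounded:
  fixes f :: "real \<Rightarrow> real"
  assumes "finite_measure M" "sets M = sets borel" "AE s in M. s \<in> {a..b}"
    and "continuous_on UNIV f"
  shows "integrable M f"
proof -
  have "bounded (f ` {a..b})"
    using assms(4) by (intro compact_imp_bounded compact_continuous_image)
      (auto intro: continuous_on_subset)
  then obtain B where "\<And>s. s \<in> {a..b} \<Longrightarrow> norm (f s) \<le> B"
    unfolding bounded_iff by (auto simp del: atLeastAtMost_iff)
  then have "AE s in M. norm (f s) \<le> B" using assms(3) by auto
  moreover have "f \<in> borel_measurable M"
    using borel_measurable_continuous_onI[OF assms(4)] assms(2)
    by (simp cong: measurable_cong_sets)
  ultimately show ?thesis by (rule finite_measure.integrable_const_bound[OF assms(1)])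
qed

lemma infdist_eq_dist_node:
  fixes x :: "nat \<Rightarrow> real"
  shows "\<exists>k\<le>n. infdist s (x ` {..n}) = \<bar>s - x k\<bar>"
proof -
  have "\<exists>y\<in>x ` {..n}. infdist s (x ` {..n}) = dist s y"
  proof (rule infdist_attains_inf)
    show "closed (x ` {..n})" by (simp add: finite_imp_closed)
  qed auto
  then show ?thesis by (auto simp: dist_real_def)
qed

lemma infdist_le_node:
  fixes x :: "nat \<Rightarrow> real"
  shows "k \<le> n \<Longrightarrow> infdist s (x ` {..n}) \<le> \<bar>s - x k\<bar>"
  using infdist_le[of "x k" "x ` {..n}" s] by (auto simp: dist_real_def)

lemma node_separation:
  fixes x :: "nat \<Rightarrow> real"
  assumes "inj_on x {..n}"
  shows "\<exists>r>0. r \<le> 1 \<and> (\<forall>i\<le>n. \<forall>j\<le>n. i \<noteq> j \<longrightarrow> 2 * r \<le> \<bar>x i - x j\<bar>)"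
proof -
  \<comment> \<open>Half distances, because a point nearest to one node is then at distance at least
    \<open>r\<close> from every other node. The extra element 1 keeps the set nonempty and gives
    \<open>r \<le> 1\<close>.\<close>
  define S where
    "S = insert 1 ((\<lambda>(i, j). \<bar>x i - x j\<bar> / 2) ` {(i, j). i \<le> n \<and> j \<le> n \<and> i \<noteq> j})"
  have "{(i, j). i \<le> n \<and> j \<le> n \<and> i \<noteq> j} \<subseteq> {..n} \<times> {..n}" by auto
  then have fin: "finite S"
    unfolding S_def by (intro finite.insertI finite_imageI) (rule finite_subset, auto)
  have pos: "0 < u" if "u \<in> S" for u
    using that assms by (auto simp: S_def inj_on_def)
  have "\<bar>x i - x j\<bar> / 2 \<in> S" if "i \<le> n" "j \<le> n" "i \<noteq> j" for i j
    using that by (auto simp: S_def)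
  then have "2 * Min S \<le> \<bar>x i - x j\<bar>" if "i \<le> n" "j \<le> n" "i \<noteq> j" for i j
    using Min_le[OF fin, of "\<bar>x i - x j\<bar> / 2"] that by fastforce
  moreover have "Min S \<le> 1" by (rule Min_le[OF fin]) (simp add: S_def)
  moreover have "0 < Min S" using Min_in[OF fin] pos by (auto simp: S_def)
  ultimately show ?thesis by blast
qed

section \<open>Lagrange interpolation at the nodes\<close>

definition lagrange_basis :: "nat \<Rightarrow> (nat \<Rightarrow> real) \<Rightarrow> nat \<Rightarrow> real poly" where
  "lagrange_basis n x i = (\<Prod>j\<in>{..n} - {i}. smult (1 / (x i - x j)) [:- x j, 1:])"

lemma degree_lagrange_basis:
  assumes "i \<le> n"
  shows "degree (lagrange_basis n x i) \<le> n"
proof -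
  have "degree (lagrange_basis n x i)
      \<le> (\<Sum>j\<in>{..n} - {i}. degree (smult (1 / (x i - x j)) [:- x j, 1:]))"
    unfolding lagrange_basis_def
    using degree_prod_sum_le[of "{..n} - {i}" "\<lambda>j. smult (1 / (x i - x j)) [:- x j, 1:]"]
    by (simp only: o_def finite_Diff finite_atMost)
  also have "\<dots> \<le> (\<Sum>j\<in>{..n} - {i}. 1)"
    by (intro sum_mono order.trans[OF degree_smult_le]) simp
  also have "\<dots> = n" using assms by simp
  finally show ?thesis .
qed

lemma poly_lagrange_basis:
  assumes "inj_on x {..n}" "i \<le> n" "k \<le> n"
  shows "poly (lagrange_basis n x i) (x k) = (if k = i then 1 else 0)"
proof (cases "k = i")
  case True
  have "x i - x j \<noteq> 0" if "j \<in> {..n} - {i}" for j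
    using that assms by (auto simp: inj_on_def)
  then have "(\<Prod>j\<in>{..n} - {i}. poly (smult (1 / (x i - x j)) [:- x j, 1:]) (x i)) = (\<Prod>j\<in>{..n} - {i}. 1)"
    by (intro prod.cong) (auto simp: diff_divide_distrib[symmetric])
  then show ?thesis using True by (simp only: lagrange_basis_def poly_prod) simp
next
  case False
  then have "k \<in> {..n} - {i}" using assms by auto
  then show ?thesis using False by (auto simp: lagrange_basis_def poly_prod intro!: prod_zero)
qed

text \<open>\<open>\<phi> k s\<close> acts as the conditional probability of sending mass at
  \<open>s\<close> to \<open>x k\<close>, so the mass at a point may be split. Assumption
  \<open>one\<close> fixes the first marginal of the resulting plan, \<open>mass\<close> the
  second.\<close>

lemma wasserstein1_le_partition_of_unity:
  fixes \<phi> :: "nat \<Rightarrow> real \<Rightarrow> ennreal" and x :: "nat \<Rightarrow> real" and c :: "nat \<Rightarrow> ennreal"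
  assumes "prob_space \<nu>" and sets[measurable_cong]: "sets \<nu> = sets borel"
    and phi[measurable]: "\<And>k. \<phi> k \<in> borel_measurable borel"
    and one: "AE s in \<nu>. (\<Sum>k\<le>n. \<phi> k s) = 1"
    and mass: "\<And>k. k \<le> n \<Longrightarrow> (\<integral>\<^sup>+s. \<phi> k s \<partial>\<nu>) = c k"
  shows "wasserstein1 \<nu> (distr (point_measure {..n} c) borel x)
    \<le> (\<integral>\<^sup>+s. (\<Sum>k\<le>n. \<phi> k s * ennreal \<bar>s - x k\<bar>) \<partial>\<nu>)"
proof -
  interpret prob_space \<nu> by fact
  let ?C = "count_space {..n}"
  interpret C: sigma_finite_measure ?C
    by (rule sigma_finite_measure_count_space_finite) simp
  define \<psi> where "\<psi> = (\<lambda>z. \<phi> (snd z) (fst z))"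
  define T where "T = (\<lambda>z. (fst z :: real, x (snd z)))"
  have psi: "\<psi> \<in> borel_measurable (\<nu> \<Otimes>\<^sub>M ?C)"
    unfolding \<psi>_def
    by (rule measurable_compose_countable'[where I = "{..n}" and g = snd]) auto
  have T: "T \<in> measurable (\<nu> \<Otimes>\<^sub>M ?C) (borel \<Otimes>\<^sub>M borel)"
  proof -
    have "(\<lambda>z. x (snd z)) \<in> measurable (\<nu> \<Otimes>\<^sub>M ?C) borel"
      by (rule measurable_compose[OF measurable_snd]) simp
    moreover have "fst \<in> measurable (\<nu> \<Otimes>\<^sub>M ?C) borel"
      using measurable_fst[of \<nu> ?C] sets by (simp cong: measurable_cong_sets)
    ultimately show ?thesis unfolding T_def by (intro measurable_Pair)
  qed
  define G where "G = distr (density (\<nu> \<Otimes>\<^sub>M ?C) \<psi>) (borel \<Otimes>\<^sub>M borel) T"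
  \<comment> \<open>One integration formula for the plan yields both marginals and the cost, by
    varying \<open>f\<close>.\<close>
  have G: "(\<integral>\<^sup>+z. f z \<partial>G) = (\<integral>\<^sup>+s. (\<Sum>k\<le>n. \<phi> k s * f (s, x k)) \<partial>\<nu>)"
    if f: "f \<in> borel_measurable (borel \<Otimes>\<^sub>M borel)" for f
  proof -
    have fT: "(\<lambda>z. f (T z)) \<in> borel_measurable (\<nu> \<Otimes>\<^sub>M ?C)"
      using measurable_compose[OF T f] .
    have "(\<integral>\<^sup>+z. f z \<partial>G) = (\<integral>\<^sup>+z. f (T z) \<partial>density (\<nu> \<Otimes>\<^sub>M ?C) \<psi>)"
      unfolding G_def by (rule nn_integral_distr) (use T f in simp_all)
    also have "\<dots> = (\<integral>\<^sup>+z. \<psi> z * f (T z) \<partial>(\<nu> \<Otimes>\<^sub>M ?C))"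
      by (rule nn_integral_density[OF psi fT])
    also have "\<dots> = (\<integral>\<^sup>+s. (\<integral>\<^sup>+k. \<psi> (s, k) * f (T (s, k)) \<partial>?C) \<partial>\<nu>)"
      by (rule C.nn_integral_fst[symmetric]) (use psi fT in simp)
    finally show ?thesis by (simp add: nn_integral_count_space_finite \<psi>_def T_def)
  qed
  have "G \<in> couplings \<nu> (distr (point_measure {..n} c) borel x)"
    unfolding couplings_def
  proof (intro CollectI conjI)
    show Gs: "sets G = sets (borel \<Otimes>\<^sub>M borel)" by (simp add: G_def)
    note [measurable_cong] = Gs
    show "distr G borel fst = \<nu>"
    proof (rule measure_eqI)
      fix A assume "A \<in> sets (distr G borel fst)"
      then have A[measurable]: "A \<in> sets borel" by simp
      have "emeasure (distr G borel fst) A = (\<integral>\<^sup>+z. indicator A z \<partial>distr G borel fst)"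
        by (subst nn_integral_indicator) auto
      also have "\<dots> = (\<integral>\<^sup>+z. indicator A (fst z) \<partial>G)"
        by (subst nn_integral_distr) auto
      also have "\<dots> = (\<integral>\<^sup>+s. (\<Sum>k\<le>n. \<phi> k s * indicator A s) \<partial>\<nu>)"
        by (subst G) auto
      also have "\<dots> = (\<integral>\<^sup>+s. indicator A s \<partial>\<nu>)"
        using one by (intro nn_integral_cong_AE) (auto simp: sum_distrib_right[symmetric])
      finally show "emeasure (distr G borel fst) A = emeasure \<nu> A"
        using A sets by simp
    qed (simp add: sets)
    show "distr G borel snd = distr (point_measure {..n} c) borel x"
    proof (rule measure_eqI)
      fix A assume "A \<in> sets (distr G borel snd)"
      then have A[measurable]: "A \<in> sets borel" by simp
      have "emeasure (distr G borel snd) A = (\<integral>\<^sup>+z. indicator A z \<partial>distr G borel snd)"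
        by (subst nn_integral_indicator) auto
      also have "\<dots> = (\<integral>\<^sup>+z. indicator A (snd z) \<partial>G)"
        by (subst nn_integral_distr) auto
      also have "\<dots> = (\<integral>\<^sup>+s. (\<Sum>k\<le>n. \<phi> k s * indicator A (x k)) \<partial>\<nu>)"
        by (subst G) auto
      also have "\<dots> = (\<Sum>k\<le>n. \<integral>\<^sup>+s. \<phi> k s * indicator A (x k) \<partial>\<nu>)"
        by (rule nn_integral_sum) simp
      also have "\<dots> = (\<Sum>k\<le>n. c k * indicator A (x k))"
        by (intro sum.cong refl, subst nn_integral_multc) (auto simp: mass)
      also have "\<dots> = (\<integral>\<^sup>+k. indicator A (x k) \<partial>point_measure {..n} c)"
        by (subst nn_integral_point_measure_finite) auto
      also have "\<dots> = (\<integral>\<^sup>+z. indicator A z \<partial>distr (point_measure {..n} c) borel x)"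
        by (subst nn_integral_distr) auto
      also have "\<dots> = emeasure (distr (point_measure {..n} c) borel x) A"
        by (subst nn_integral_indicator) auto
      finally show "emeasure (distr G borel snd) A
          = emeasure (distr (point_measure {..n} c) borel x) A" .
    qed simp
  qed
  then have "wasserstein1 \<nu> (distr (point_measure {..n} c) borel x)
      \<le> (\<integral>\<^sup>+ (s, r). ennreal \<bar>s - r\<bar> \<partial>G)"
    unfolding wasserstein1_def by (rule INF_lower)
  also have "\<dots> = (\<integral>\<^sup>+s. (\<Sum>k\<le>n. \<phi> k s * ennreal \<bar>s - x k\<bar>) \<partial>\<nu>)"
    by (subst G) auto
  finally show ?thesis .
qed

section \<open>Stability of a quadrature rule\<close>

text \<open>What stability needs from the Gauss and the Gauss-Radau rule alike. Only the lower nodes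
  \<open>k < n\<close> enter \<open>h_node\<close> and \<open>h_lower\<close>;
  \<open>degree_h\<close> leaves room for the linear factor of the top node.\<close>

locale quadrature = poly_moments +
  fixes n t :: nat and x l :: "nat \<Rightarrow> real" and h :: "real poly"
  assumes nodes_less: "\<And>i j. i < j \<Longrightarrow> j \<le> n \<Longrightarrow> x i < x j"
    and nodes_bounds: "\<And>k. k \<le> n \<Longrightarrow> x k \<in> {-1..1}"
    and exact: "\<And>q. degree q \<le> t \<Longrightarrow> (\<Sum>k\<le>n. l k * poly q (x k)) = (\<integral>s. poly q s \<partial>M)"
    and degree_le: "2 * n \<le> t"
    and degree_h: "degree h < t"
    and h_node: "\<And>k. k < n \<Longrightarrow> poly h (x k) = 0"
    and h_lower: "\<exists>c>0. \<forall>s\<in>{-1..2}. c * (\<Prod>k<n. (s - x k)\<^sup>2) \<le> poly h s"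
begin

text \<open>The bound \<open>\<alpha> \<le> x n + 1\<close> puts every support into the fixed
  interval [-1, 2], which lets the constants be independent of \<open>\<nu>\<close> and
  \<open>\<alpha>\<close>.\<close>

definition competitor :: "real measure \<Rightarrow> real \<Rightarrow> bool" where
  "competitor \<nu> \<alpha> \<longleftrightarrow> x n \<le> \<alpha> \<and> \<alpha> \<le> x n + 1 \<and> prob_space \<nu> \<and> sets \<nu> = sets borel \<and>
     (AE s in \<nu>. s \<in> {-1..\<alpha>}) \<and> (\<forall>k\<le>t. (\<integral>s. s ^ k \<partial>\<nu>) = (\<integral>s. s ^ k \<partial>M))"

abbreviation X :: "real set" where "X \<equiv> x ` {..n}"

lemma inj_nodes: "inj_on x {..n}"
  by (rule inj_onI) (metis atMost_iff less_irrefl nodes_less linorder_neqE_nat)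

lemma nodes_range: "k \<le> n \<Longrightarrow> x k \<in> {-1..2}"
  using nodes_bounds[of k] by auto

lemma competitor_AE: "competitor \<nu> \<alpha> \<Longrightarrow> AE s in \<nu>. s \<in> {-1..\<alpha>} \<and> s \<in> {-1..2}"
  using nodes_bounds[of n] unfolding competitor_def
  by (elim conjE) (erule eventually_mono, auto)

lemma competitor_integrable:
  fixes f :: "real \<Rightarrow> real"
  assumes "competitor \<nu> \<alpha>" "continuous_on UNIV f"
  shows "integrable \<nu> f"
  using assms competitor_AE[OF assms(1)]
  by (intro integrable_continuous_on_bounded[where a = "-1" and b = 2])
     (auto simp: competitor_def prob_space.finite_measure)

lemma competitor_integrable_infdist: "competitor \<nu> \<alpha> \<Longrightarrow> integrable \<nu> (\<lambda>s. infdist s X)"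
  by (rule competitor_integrable) (auto intro: continuous_intros)

lemma competitor_integral_poly:
  assumes "competitor \<nu> \<alpha>" "degree p \<le> t"
  shows "(\<integral>s. poly p s \<partial>\<nu>) = (\<integral>s. poly p s \<partial>M)"
proof -
  have "(\<integral>s. poly p s \<partial>\<nu>) = (\<Sum>i\<le>degree p. coeff p i * (\<integral>s. s ^ i \<partial>\<nu>))"
    unfolding poly_altdef
    by (subst Bochner_Integration.integral_sum)
       (auto intro!: competitor_integrable[OF assms(1)] continuous_intros)
  also have "\<dots> = (\<Sum>i\<le>degree p. coeff p i * (\<integral>s. s ^ i \<partial>M))"
    using assms by (intro sum.cong) (auto simp: competitor_def)
  also have "\<dots> = (\<integral>s. poly p s \<partial>M)"
  proof -
    have "integrable M (\<lambda>s. s ^ i)" for i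
      using integrable_poly[of "monom 1 i"] by (subst (asm) Bochner_Integration.integrable_cong[OF refl poly_monom]) simp
    then show ?thesis
      unfolding poly_altdef by (subst Bochner_Integration.integral_sum) auto
  qed
  finally show ?thesis .
qed

section \<open>The quadrature weights\<close>

lemma weight_eq:
  assumes "k \<le> n"
  shows "l k = (\<integral>s. poly (lagrange_basis n x k) s \<partial>M)"
proof -
  have "(\<integral>s. poly (lagrange_basis n x k) s \<partial>M)
      = (\<Sum>j\<le>n. l j * poly (lagrange_basis n x k) (x j))"
    using degree_lagrange_basis[OF assms, of x] degree_le by (intro exact[symmetric]) simp
  also have "\<dots> = (\<Sum>j\<le>n. if j = k then l j else 0)"
    using assms by (intro sum.cong) (auto simp: poly_lagrange_basis[OF inj_nodes])
  also have "\<dots> = l k" using assms by simp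
  finally show ?thesis ..
qed

text \<open>The squared basis polynomial has degree at most 2 n, still within exactness, and picks
  out the single node \<open>x k\<close>. Strict positivity leaves room to correct the cell masses
  in the transport plan.\<close>

lemma weight_pos:
  assumes "k \<le> n"
  shows "0 < l k"
proof -
  let ?q = "lagrange_basis n x k * lagrange_basis n x k"
  have "poly (lagrange_basis n x k) (x k) = 1"
    using assms by (simp add: poly_lagrange_basis[OF inj_nodes])
  then have "lagrange_basis n x k \<noteq> 0" by auto
  then have "0 < (\<integral>s. poly ?q s \<partial>M)" by (intro integral_poly_pos) auto
  also have "\<dots> = (\<Sum>j\<le>n. l j * poly ?q (x j))"
  proof (rule exact[symmetric])
    have "degree ?q \<le> n + n"
      using degree_lagrange_basis[OF assms, of x] by (intro order.trans[OF degree_mult_le]) simp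
    then show "degree ?q \<le> t" using degree_le by simp
  qed
  also have "\<dots> = (\<Sum>j\<le>n. if j = k then l j else 0)"
    using assms by (intro sum.cong) (auto simp: poly_lagrange_basis[OF inj_nodes])
  also have "\<dots> = l k" using assms by simp
  finally show ?thesis .
qed

lemma sum_weights:
  assumes "competitor \<nu> \<alpha>"
  shows "(\<Sum>k\<le>n. l k) = 1"
proof -
  interpret prob_space \<nu> using assms by (simp add: competitor_def)
  have "(\<Sum>k\<le>n. l k) = (\<integral>s. poly 1 s \<partial>M)" using exact[of 1] by simp
  also have "\<dots> = (\<integral>s. poly 1 s \<partial>\<nu>)" using competitor_integral_poly[OF assms, of 1] by simp
  finally show ?thesis by (simp add: prob_space)
qed

text \<open>Away from the node nearest to \<open>s\<close>, every factor of the product is bounded below by the node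
  separation; the factor of the nearest node is the squared distance itself.\<close>

lemma infdist_sq_le:
  "\<exists>c>0. \<forall>s\<in>{-1..2}. c * (infdist s X)\<^sup>2 \<le> poly h s * \<bar>s - x n\<bar>"
proof -
  obtain r where r: "0 < r" "r \<le> 1"
    and sep: "\<And>i j. i \<le> n \<Longrightarrow> j \<le> n \<Longrightarrow> i \<noteq> j \<Longrightarrow> 2 * r \<le> \<bar>x i - x j\<bar>"
    using node_separation[OF inj_nodes] by blast
  obtain c where c: "0 < c"
    and low: "\<And>s. s \<in> {-1..2} \<Longrightarrow> c * (\<Prod>k<n. (s - x k)\<^sup>2) \<le> poly h s"
    using h_lower by blast
  \<comment> \<open>The factor \<open>r / 3\<close> accounts for the top node, which enters only to
    the first power. If it is the nearest one, a squared distance has to be bounded by a distance,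
    and distances are at most 3 here; otherwise its factor is at least \<open>r\<close>.\<close>
  have key: "(r\<^sup>2) ^ n * (r / 3) * (infdist s X)\<^sup>2 \<le> (\<Prod>k<n. (s - x k)\<^sup>2) * \<bar>s - x n\<bar>"
    if s: "s \<in> {-1..2}" for s
  proof -
    obtain k where k: "k \<le> n" and D: "infdist s X = \<bar>s - x k\<bar>"
      using infdist_eq_dist_node by blast
    have far: "r \<le> \<bar>s - x j\<bar>" if "j \<le> n" "j \<noteq> k" for j
      using sep[of j k] infdist_le_node[of j n s x] D that k by (smt (verit))
    have far2: "r\<^sup>2 \<le> (s - x j)\<^sup>2" if "j \<le> n" "j \<noteq> k" for j
      using power_mono[OF far[OF that], of 2] r by simp
    have D3: "\<bar>s - x k\<bar> \<le> 3" using s nodes_bounds[OF k] by auto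
    show ?thesis
    proof (cases "k = n")
      case True
      have "(\<Prod>j<n. r\<^sup>2) \<le> (\<Prod>j<n. (s - x j)\<^sup>2)"
        by (intro prod_mono) (use far2 True in auto)
      moreover have "(r / 3) * (infdist s X)\<^sup>2 \<le> \<bar>s - x n\<bar>"
      proof -
        have "(infdist s X)\<^sup>2 \<le> 3 * \<bar>s - x n\<bar>"
          using mult_right_mono[OF D3, of "\<bar>s - x k\<bar>"] D True
          by (simp add: power2_eq_square)
        then have "r * (infdist s X)\<^sup>2 \<le> 1 * (3 * \<bar>s - x n\<bar>)"
          using r by (intro mult_mono) auto
        then show ?thesis by simp
      qed
      ultimately have "(r\<^sup>2) ^ n * ((r / 3) * (infdist s X)\<^sup>2) \<le> (\<Prod>j<n. (s - x j)\<^sup>2) * \<bar>s - x n\<bar>"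
        using r by (intro mult_mono) (auto intro: prod_nonneg)
      then show ?thesis by (simp only: mult.assoc)
    next
      case False
      then have kn: "k < n" using k by simp
      \<comment> \<open>Only n - 1 lower nodes remain besides the nearest; \<open>r \<le> 1\<close>
        allows padding to the exponent n.\<close>
      have "(r\<^sup>2) ^ n \<le> (r\<^sup>2) ^ (n - 1)"
        using r by (intro power_decreasing) (auto simp: power_le_one)
      also have "\<dots> = (\<Prod>j\<in>{..<n} - {k}. r\<^sup>2)" using kn by simp
      also have "\<dots> \<le> (\<Prod>j\<in>{..<n} - {k}. (s - x j)\<^sup>2)"
        by (intro prod_mono) (use far2 in auto)
      finally have "(r\<^sup>2) ^ n * (s - x k)\<^sup>2 \<le> (\<Prod>j\<in>{..<n} - {k}. (s - x j)\<^sup>2) * (s - x k)\<^sup>2"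
        by (rule mult_right_mono) simp
      also have "\<dots> = (\<Prod>j<n. (s - x j)\<^sup>2)"
        using kn prod.remove[of "{..<n}" k "\<lambda>j. (s - x j)\<^sup>2"] by (simp add: mult.commute)
      finally have 1: "(r\<^sup>2) ^ n * (s - x k)\<^sup>2 \<le> (\<Prod>j<n. (s - x j)\<^sup>2)" .
      have "r / 3 \<le> \<bar>s - x n\<bar>" using far[of n] False r by simp
      then have "((r\<^sup>2) ^ n * (s - x k)\<^sup>2) * (r / 3) \<le> (\<Prod>j<n. (s - x j)\<^sup>2) * \<bar>s - x n\<bar>"
        using 1 r by (intro mult_mono) (auto intro: prod_nonneg)
      then show ?thesis using D by (simp add: mult_ac)
    qed
  qed
  have "c * ((r\<^sup>2) ^ n * (r / 3)) * (infdist s X)\<^sup>2 \<le> poly h s * \<bar>s - x n\<bar>" if "s \<in> {-1..2}" for s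
  proof -
    have "c * ((r\<^sup>2) ^ n * (r / 3) * (infdist s X)\<^sup>2)
        \<le> c * ((\<Prod>k<n. (s - x k)\<^sup>2) * \<bar>s - x n\<bar>)"
      using key[OF that] c by (intro mult_left_mono) auto
    also have "\<dots> \<le> poly h s * \<bar>s - x n\<bar>"
      using mult_right_mono[OF low[OF that], of "\<bar>s - x n\<bar>"] by (simp add: mult_ac)
    finally show ?thesis by (simp add: mult_ac)
  qed
  moreover have "0 < c * ((r\<^sup>2) ^ n * (r / 3))" using c r by simp
  ultimately show ?thesis by blast
qed

text \<open>The polynomial \<open>h s * (s - x n)\<close> vanishes at all nodes, so its integral is zero, while beyond
  the last node it is at most a multiple of \<open>\<alpha> - x n\<close>.\<close>

lemma second_moment_bound:
  "\<exists>C>0. \<forall>\<nu> \<alpha>. competitor \<nu> \<alpha> \<longrightarrow> (\<integral>s. (infdist s X)\<^sup>2 \<partial>\<nu>) \<le> C * (\<alpha> - x n)"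
proof -
  obtain c where c: "0 < c"
    and low: "\<And>s. s \<in> {-1..2} \<Longrightarrow> c * (infdist s X)\<^sup>2 \<le> poly h s * \<bar>s - x n\<bar>"
    using infdist_sq_le by blast
  obtain c' where c': "0 < c'" "\<And>s. s \<in> {-1..2} \<Longrightarrow> c' * (\<Prod>k<n. (s - x k)\<^sup>2) \<le> poly h s"
    using h_lower by blast
  have h0: "0 \<le> poly h s" if "s \<in> {-1..2}" for s
    using c'(2)[OF that] c'(1)
    by (smt (verit) mult_nonneg_nonneg prod_nonneg zero_le_power2)
  have "bounded (poly h ` {-1..2})"
    by (intro compact_imp_bounded compact_continuous_image continuous_intros) simp
  then obtain H where H: "0 < H" "\<And>s. s \<in> {-1..2} \<Longrightarrow> poly h s \<le> H"
    unfolding bounded_pos by (metis imageI real_norm_def abs_le_D1)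
  define f where "f = h * [:- x n, 1:]"
  have f0: "(\<integral>s. poly f s \<partial>\<nu>) = 0" if "competitor \<nu> \<alpha>" for \<nu> \<alpha>
  proof -
    have "degree f \<le> degree h + 1"
      unfolding f_def by (rule order.trans[OF degree_mult_le]) simp
    then have df: "degree f \<le> t" using degree_h by simp
    have "poly f (x k) = 0" if "k \<le> n" for k
      using h_node[of k] that by (cases "k = n") (auto simp: f_def)
    then have "(\<Sum>k\<le>n. l k * poly f (x k)) = 0" by simp
    then show ?thesis using exact[OF df] competitor_integral_poly[OF that df] by simp
  qed
  have "(\<integral>s. (infdist s X)\<^sup>2 \<partial>\<nu>) \<le> 2 * H / c * (\<alpha> - x n)" if comp: "competitor \<nu> \<alpha>" for \<nu> \<alpha>
  proof -
    interpret prob_space \<nu> using comp by (simp add: competitor_def)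
    have d: "0 \<le> \<alpha> - x n" using comp by (simp add: competitor_def)
    \<comment> \<open>With f+ the positive part of f, the absolute value is 2 f+ - f. Here f+ is at
      most \<open>H * (\<alpha> - x n)\<close>, and the term - f integrates to zero.\<close>
    have "(\<integral>s. c * (infdist s X)\<^sup>2 \<partial>\<nu>) \<le> (\<integral>s. 2 * H * (\<alpha> - x n) - poly f s \<partial>\<nu>)"
    proof (rule integral_mono_AE)
      show "AE s in \<nu>. c * (infdist s X)\<^sup>2 \<le> 2 * H * (\<alpha> - x n) - poly f s"
        using competitor_AE[OF comp]
      proof eventually_elim
        case (elim s)
        then have s: "s \<in> {-1..2}" "s \<le> \<alpha>" by auto
        have fs: "poly f s = poly h s * (s - x n)" by (simp add: f_def algebra_simps)
        show ?case
        proof (cases "s \<le> x n")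
          case True
          then have "poly h s * \<bar>s - x n\<bar> = - poly f s" by (simp add: fs algebra_simps)
          moreover have "0 \<le> 2 * H * (\<alpha> - x n)" using H(1) d by simp
          ultimately show ?thesis using low[OF s(1)] by linarith
        next
          case False
          have "poly h s * (s - x n) \<le> H * (\<alpha> - x n)"
            using H(2)[OF s(1)] h0[OF s(1)] s(2) False by (intro mult_mono) auto
          moreover have "poly h s * \<bar>s - x n\<bar> = poly f s" using False by (simp add: fs)
          ultimately show ?thesis using low[OF s(1)] fs by linarith
        qed
      qed
    qed (auto intro!: competitor_integrable[OF comp] continuous_intros)
    also have "\<dots> = 2 * H * (\<alpha> - x n)"
      using f0[OF comp] competitor_integrable[OF comp, of "poly f"]
      by (simp add: prob_space continuous_intros)
    finally show ?thesis using c by (simp add: field_simps)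
  qed
  moreover have "0 < 2 * H / c" using H(1) c by simp
  ultimately show ?thesis by blast
qed

lemma first_moment_bound:
  "\<exists>C>0. \<forall>\<nu> \<alpha>. competitor \<nu> \<alpha> \<longrightarrow> (\<integral>s. infdist s X \<partial>\<nu>) \<le> C * sqrt (\<alpha> - x n)"
proof -
  obtain C where C: "0 < C"
    and bd: "\<And>\<nu> \<alpha>. competitor \<nu> \<alpha> \<Longrightarrow> (\<integral>s. (infdist s X)\<^sup>2 \<partial>\<nu>) \<le> C * (\<alpha> - x n)"
    using second_moment_bound by blast
  have "(\<integral>s. infdist s X \<partial>\<nu>) \<le> sqrt C * sqrt (\<alpha> - x n)" if comp: "competitor \<nu> \<alpha>" for \<nu> \<alpha>
  proof -
    interpret prob_space \<nu> using comp by (simp add: competitor_def)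
    have i2: "integrable \<nu> (\<lambda>s. (infdist s X)\<^sup>2)"
      by (rule competitor_integrable[OF comp]) (auto intro!: continuous_intros)
    \<comment> \<open>Nonnegativity of the variance serves as the Cauchy-Schwarz inequality.\<close>
    have "0 \<le> (\<integral>s. (infdist s X)\<^sup>2 \<partial>\<nu>) - (\<integral>s. infdist s X \<partial>\<nu>)\<^sup>2"
      using variance_positive[of "\<lambda>s. infdist s X"]
        variance_eq[OF competitor_integrable_infdist[OF comp] i2] by simp
    then have "(\<integral>s. infdist s X \<partial>\<nu>)\<^sup>2 \<le> C * (\<alpha> - x n)" using bd[OF comp] by simp
    then show ?thesis
      by (metis real_le_rsqrt real_sqrt_mult)
  qed
  then show ?thesis using C real_sqrt_gt_zero by blast
qed

text \<open>The indicator of \<open>E i\<close> at \<open>s\<close> is the value of the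
  \<open>i\<close>-th basis polynomial at the node assigned to \<open>s\<close>, so exchanging
  \<open>s\<close> for that node costs a Lipschitz constant times \<open>D s\<close>. Cells and
  distance bound stay arbitrary because they are used twice: with \<open>nearest_cell\<close> for
  the transport plan, and with the Voronoi cells of the moved nodes.\<close>

lemma cell_weight_bound:
  obtains K where "0 < K"
    and "\<And>\<nu> \<alpha> E D. competitor \<nu> \<alpha> \<Longrightarrow> (\<And>k. k \<le> n \<Longrightarrow> E k \<in> sets borel) \<Longrightarrow> integrable \<nu> D \<Longrightarrow>
      (AE s in \<nu>. \<exists>k\<le>n. s \<in> E k \<and> \<bar>s - x k\<bar> \<le> D s \<and> (\<forall>j\<le>n. s \<in> E j \<longrightarrow> j = k)) \<Longrightarrow>
      (\<Sum>k\<le>n. \<bar>measure \<nu> (E k) - l k\<bar>) \<le> K * (\<integral>s. D s \<partial>\<nu>)"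
proof -
  have "\<forall>i. \<exists>K. \<forall>u\<in>{-1..2}. \<forall>v\<in>{-1..2}.
      \<bar>poly (lagrange_basis n x i) u - poly (lagrange_basis n x i) v\<bar> \<le> K * \<bar>u - v\<bar>"
    using poly_lipschitz_on_interval by blast
  then obtain L where L: "\<And>i u v. u \<in> {-1..2} \<Longrightarrow> v \<in> {-1..2} \<Longrightarrow>
      \<bar>poly (lagrange_basis n x i) u - poly (lagrange_basis n x i) v\<bar> \<le> L i * \<bar>u - v\<bar>"
    by metis
  \<comment> \<open>The added 1 keeps \<open>K\<close> positive even if all Lipschitz constants
    vanish.\<close>
  define K where "K = (\<Sum>i\<le>n. \<bar>L i\<bar>) + 1"
  have bound: "(\<Sum>k\<le>n. \<bar>measure \<nu> (E k) - l k\<bar>) \<le> K * (\<integral>s. D s \<partial>\<nu>)"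
    if comp: "competitor \<nu> \<alpha>" and E: "\<And>k. k \<le> n \<Longrightarrow> E k \<in> sets borel" and D: "integrable \<nu> D"
      and part: "AE s in \<nu>. \<exists>k\<le>n. s \<in> E k \<and> \<bar>s - x k\<bar> \<le> D s \<and> (\<forall>j\<le>n. s \<in> E j \<longrightarrow> j = k)"
    for \<nu> \<alpha> E D
  proof -
    interpret prob_space \<nu> using comp by (simp add: competitor_def)
    have sets: "sets \<nu> = sets borel" using comp by (simp add: competitor_def)
    have D0: "0 \<le> (\<integral>s. D s \<partial>\<nu>)"
      by (intro integral_nonneg_AE eventually_mono[OF part])
        (elim exE conjE, erule order_trans[OF abs_ge_zero])
    have each: "\<bar>measure \<nu> (E i) - l i\<bar> \<le> \<bar>L i\<bar> * (\<integral>s. D s \<partial>\<nu>)" if i: "i \<le> n" for i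
    proof -
      let ?p = "poly (lagrange_basis n x i)"
      have Ei: "E i \<in> events" using E[OF i] sets by simp
      have intp: "integrable \<nu> ?p"
        by (rule competitor_integrable[OF comp]) (auto intro!: continuous_intros)
      have inti: "integrable \<nu> (indicator (E i) :: real \<Rightarrow> real)"
        using Ei by (simp add: integrable_indicator_iff emeasure_finite less_top[symmetric])
      have "(\<integral>s. ?p s \<partial>\<nu>) = l i"
        using competitor_integral_poly[OF comp, of "lagrange_basis n x i"]
          degree_lagrange_basis[OF i, of x] degree_le weight_eq[OF i] by simp
      then have "measure \<nu> (E i) - l i = (\<integral>s. indicator (E i) s - ?p s \<partial>\<nu>)"
        using intp inti Ei sets_eq_imp_space_eq[OF sets] by simp
      then have "\<bar>measure \<nu> (E i) - l i\<bar> \<le> (\<integral>s. \<bar>indicator (E i) s - ?p s\<bar> \<partial>\<nu>)"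
        using integral_abs_bound by metis
      also have "\<dots> \<le> (\<integral>s. \<bar>L i\<bar> * D s \<partial>\<nu>)"
      proof (rule integral_mono_AE)
        show "AE s in \<nu>. \<bar>indicator (E i) s - ?p s\<bar> \<le> \<bar>L i\<bar> * D s"
          using part competitor_AE[OF comp]
        proof eventually_elim
          case (elim s)
          then obtain k where k: "k \<le> n" "s \<in> E k" "\<bar>s - x k\<bar> \<le> D s"
            and uniq: "\<And>j. j \<le> n \<Longrightarrow> s \<in> E j \<Longrightarrow> j = k" by blast
          have "s \<in> E i \<longleftrightarrow> k = i" using uniq[OF i] k by auto
          then have "indicator (E i) s = ?p (x k)"
            by (simp add: poly_lagrange_basis[OF inj_nodes i k(1)] indicator_def)
          then have "\<bar>indicator (E i) s - ?p s\<bar> \<le> L i * \<bar>x k - s\<bar>"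
            using L[OF nodes_range[OF k(1)], of s i] elim by simp
          also have "\<dots> \<le> \<bar>L i\<bar> * D s"
            using k(3) by (intro mult_mono) auto
          finally show ?case .
        qed
      qed (use intp inti D in auto)
      finally show ?thesis by simp
    qed
    have "(\<Sum>k\<le>n. \<bar>measure \<nu> (E k) - l k\<bar>) \<le> (\<Sum>k\<le>n. \<bar>L k\<bar> * (\<integral>s. D s \<partial>\<nu>))"
      by (intro sum_mono each) simp
    also have "\<dots> \<le> K * (\<integral>s. D s \<partial>\<nu>)"
      using D0 unfolding K_def sum_distrib_right[symmetric] by (intro mult_right_mono) auto
    finally show ?thesis .
  qed
  have "0 < K" unfolding K_def by (intro add_nonneg_pos sum_nonneg) auto
  then show thesis by (rule that) (rule bound)
qed

text \<open>Ties go to the smallest index, which makes the cells with \<open>k \<le> n\<close> a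
  Borel partition of the line.\<close>

definition nearest_cell :: "nat \<Rightarrow> real set" where
  "nearest_cell k =
     {s. \<bar>s - x k\<bar> = infdist s X \<and> (\<forall>j<k. \<bar>s - x j\<bar> \<noteq> infdist s X)}"

lemma nearest_cell_borel: "nearest_cell k \<in> sets borel"
proof -
  have "closed {s. \<bar>s - x j\<bar> = infdist s X}" for j
    by (intro closed_Collect_eq continuous_intros)
  then have *: "{s. \<bar>s - x j\<bar> = infdist s X} \<in> sets borel" for j
    by (rule borel_closed)
  have "nearest_cell k = {s. \<bar>s - x k\<bar> = infdist s X} - (\<Union>j<k. {s. \<bar>s - x j\<bar> = infdist s X})"
    by (auto simp: nearest_cell_def)
  also have "\<dots> \<in> sets borel"
    by (intro sets.Diff * sets.finite_UN) auto
  finally show ?thesis .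
qed

lemma nearest_cell_partition:
  "\<exists>k\<le>n. s \<in> nearest_cell k \<and> \<bar>s - x k\<bar> \<le> infdist s X \<and> (\<forall>j\<le>n. s \<in> nearest_cell j \<longrightarrow> j = k)"
proof -
  let ?P = "\<lambda>k. \<bar>s - x k\<bar> = infdist s X"
  obtain i where i: "i \<le> n" "?P i" using infdist_eq_dist_node[where s = s and x = x and n = n] by auto
  define k where "k = (LEAST k. ?P k)"
  have k: "?P k" "k \<le> i" unfolding k_def using i by (auto intro: LeastI Least_le)
  have least: "\<not> ?P j" if "j < k" for j using not_less_Least that unfolding k_def by blast
  have "s \<in> nearest_cell k" using k least by (simp add: nearest_cell_def)
  moreover have "j = k" if "s \<in> nearest_cell j" for j
    using that k(1) least[of j] unfolding nearest_cell_def
    by (metis (mono_tags, lifting) linorder_neqE_nat mem_Collect_eq)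
  moreover have "k \<le> n" using k(2) i(1) by simp
  ultimately show ?thesis using eq_refl[OF k(1)] by blast
qed

text \<open>The transport plan keeps the fraction \<open>1 - \<theta>\<close> of each nearest-node cell at its node and spreads
  the remaining mass independently of the position, with the proportions needed to hit the
  weights; these are nonnegative as soon as \<open>\<theta> * l k\<close> dominates the error of the cell masses.\<close>

lemma wasserstein_bound:
  "\<exists>\<epsilon>>0. \<exists>C>0. \<forall>\<nu> \<alpha>. competitor \<nu> \<alpha> \<longrightarrow> \<alpha> - x n \<le> \<epsilon> \<longrightarrow>
     wasserstein1 \<nu> (distr (point_measure {..n} (\<lambda>k. ennreal (l k))) borel x)
       \<le> ennreal (C * sqrt (\<alpha> - x n))"
proof -
  obtain A where A: "0 < A"
    and first: "\<And>\<nu> \<alpha>. competitor \<nu> \<alpha> \<Longrightarrow> (\<integral>s. infdist s X \<partial>\<nu>) \<le> A * sqrt (\<alpha> - x n)"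
    using first_moment_bound by blast
  obtain K where K: "0 < K"
    and cells: "\<And>\<nu> \<alpha> E D. competitor \<nu> \<alpha> \<Longrightarrow> (\<And>k. k \<le> n \<Longrightarrow> E k \<in> sets borel) \<Longrightarrow> integrable \<nu> D \<Longrightarrow>
     (AE s in \<nu>. \<exists>k\<le>n. s \<in> E k \<and> \<bar>s - x k\<bar> \<le> D s \<and> (\<forall>j\<le>n. s \<in> E j \<longrightarrow> j = k)) \<Longrightarrow>
     (\<Sum>k\<le>n. \<bar>measure \<nu> (E k) - l k\<bar>) \<le> K * (\<integral>s. D s \<partial>\<nu>)"
  proof (rule cell_weight_bound, goal_cases)
    case (1 K)
    show ?case by (rule 1(1)) (fact 1(2), rule 1(3))
  qed
  define m where "m = Min (l ` {..n})"
  have m: "0 < m" "\<And>k. k \<le> n \<Longrightarrow> m \<le> l k"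
    unfolding m_def using weight_pos by (auto simp: Min_gr_iff)
  \<comment> \<open>Tuned so that \<open>\<theta> = B * sqrt (\<alpha> - x n)\<close> satisfies
    \<open>\<theta> * m = K * A * sqrt (\<alpha> - x n)\<close>, the bound for the total error of
    the cell masses. The threshold \<open>(1 / B)\<^sup>2\<close> then says that \<theta> is at most
    1.\<close>
  define B where "B = K * A / m"
  have B: "0 < B" unfolding B_def using K A m by simp
  have "wasserstein1 \<nu> (distr (point_measure {..n} (\<lambda>k. ennreal (l k))) borel x)
       \<le> ennreal ((A + 3 * B) * sqrt (\<alpha> - x n))"
    if comp: "competitor \<nu> \<alpha>" and small: "\<alpha> - x n \<le> (1 / B)\<^sup>2" for \<nu> \<alpha>
  proof -
    interpret prob_space \<nu> using comp by (simp add: competitor_def)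
    have sets: "sets \<nu> = sets borel" using comp by (simp add: competitor_def)
    have d0: "0 \<le> \<alpha> - x n" using comp by (simp add: competitor_def)
    define w where "w k = measure \<nu> (nearest_cell k)" for k
    define \<theta> where "\<theta> = B * sqrt (\<alpha> - x n)"
    have "sqrt (\<alpha> - x n) \<le> 1 / B" using small B by (intro real_le_lsqrt) auto
    then have th: "0 \<le> \<theta>" "\<theta> \<le> 1"
      unfolding \<theta>_def using B d0 by (auto simp: field_simps)
    have err: "(\<Sum>k\<le>n. \<bar>w k - l k\<bar>) \<le> \<theta> * m"
    proof -
      have "(\<Sum>k\<le>n. \<bar>w k - l k\<bar>) \<le> K * (\<integral>s. infdist s X \<partial>\<nu>)"
        unfolding w_def
        by (rule cells[OF comp]) (simp_all add: nearest_cell_borel nearest_cell_partition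
            competitor_integrable_infdist[OF comp])
      also have "\<dots> \<le> K * (A * sqrt (\<alpha> - x n))"
        using first[OF comp] K by simp
      also have "\<dots> = \<theta> * m" unfolding \<theta>_def B_def using m by simp
      finally show ?thesis .
    qed
    define g where "g k = l k - (1 - \<theta>) * w k" for k
    have g0: "0 \<le> g k" if k: "k \<le> n" for k
    proof -
      have "\<bar>w k - l k\<bar> \<le> (\<Sum>k\<le>n. \<bar>w k - l k\<bar>)"
        using k by (intro member_le_sum) auto
      also have "\<dots> \<le> \<theta> * l k"
        using err mult_left_mono[OF m(2)[OF k] th(1)] by linarith
      \<comment> \<open>The error bound gives \<open>w k \<le> (1 + \<theta>) * l k\<close>, and the
        product of 1 - \<theta> and 1 + \<theta> does not exceed 1.\<close>
      finally have "(1 - \<theta>) * w k \<le> (1 - \<theta>) * ((1 + \<theta>) * l k)"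
        using th by (intro mult_left_mono) (auto simp: algebra_simps)
      also have "\<dots> = l k - \<theta>\<^sup>2 * l k" by (simp add: algebra_simps power2_eq_square)
      also have "\<dots> \<le> l k" using weight_pos[OF k] by simp
      finally show ?thesis by (simp add: g_def)
    qed
    have one: "(\<Sum>k\<le>n. indicator (nearest_cell k) s * f k) = f i"
      if "i \<le> n" "s \<in> nearest_cell i" for f :: "nat \<Rightarrow> real" and s i
    proof -
      have "(\<Sum>k\<le>n. indicator (nearest_cell k) s * f k) = (\<Sum>k\<le>n. if k = i then f k else 0)"
      proof (intro sum.cong refl)
        fix k assume "k \<in> {..n}"
        then have "s \<in> nearest_cell k \<longleftrightarrow> k = i"
          using nearest_cell_partition[of s] that by (metis atMost_iff)
        then show "indicator (nearest_cell k) s * f k = (if k = i then f k else 0)"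
          by (simp add: indicator_def)
      qed
      then show ?thesis using that by simp
    qed
    have intc: "integrable \<nu> (indicator (nearest_cell k) :: real \<Rightarrow> real)" for k
      using nearest_cell_borel sets
      by (simp add: integrable_indicator_iff emeasure_finite less_top[symmetric])
    have int1: "(\<integral>s. indicator (nearest_cell k) s \<partial>\<nu>) = w k" for k
      unfolding w_def using sets_eq_imp_space_eq[OF sets] by simp
    have "(\<Sum>k\<le>n. w k) = (\<integral>s. (\<Sum>k\<le>n. indicator (nearest_cell k) s) \<partial>\<nu>)"
      using intc int1 by (simp add: Bochner_Integration.integral_sum)
    also have "\<dots> = (\<integral>s. 1 \<partial>\<nu>)"
    proof (rule Bochner_Integration.integral_cong[OF refl])
      fix s
      obtain i where "i \<le> n" "s \<in> nearest_cell i" using nearest_cell_partition by blast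
      then show "(\<Sum>k\<le>n. indicator (nearest_cell k) s) = (1 :: real)"
        using one[of i s "\<lambda>_. 1"] by simp
    qed
    finally have sum_w: "(\<Sum>k\<le>n. w k) = 1" by (simp add: prob_space)
    have sum_g: "(\<Sum>k\<le>n. g k) = \<theta>"
      unfolding g_def using sum_w sum_weights[OF comp]
      by (simp add: sum_subtractf sum_distrib_left[symmetric])
    define u where "u k s = (1 - \<theta>) * indicator (nearest_cell k) s + g k" for k s
    have u0: "0 \<le> u k s" if "k \<le> n" for k s
      unfolding u_def using g0[OF that] th by simp
    have um: "u k \<in> borel_measurable borel" for k
      unfolding u_def using nearest_cell_borel by measurable
    have u1: "(\<Sum>k\<le>n. u k s) = 1" for s
    proof -
      obtain i where "i \<le> n" "s \<in> nearest_cell i" using nearest_cell_partition by blast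
      then show ?thesis
        using one[of i s "\<lambda>_. 1"] sum_g
        by (simp add: u_def sum.distrib sum_distrib_left[symmetric])
    qed
    have eu1: "(\<Sum>k\<le>n. ennreal (u k s)) = 1" for s
      using u0 u1[of s] by (subst sum_ennreal) auto
    have ui: "integrable \<nu> (u k)" for k unfolding u_def using intc by simp
    have mass: "(\<integral>\<^sup>+s. ennreal (u k s) \<partial>\<nu>) = ennreal (l k)" if "k \<le> n" for k
    proof -
      have "(\<integral>\<^sup>+s. ennreal (u k s) \<partial>\<nu>) = ennreal (\<integral>s. u k s \<partial>\<nu>)"
        using ui u0[OF that] by (intro nn_integral_eq_integral) auto
      also have "(\<integral>s. u k s \<partial>\<nu>) = l k"
        unfolding u_def using intc int1 by (simp add: prob_space g_def)
      finally show ?thesis .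
    qed
    have "wasserstein1 \<nu> (distr (point_measure {..n} (\<lambda>k. ennreal (l k))) borel x)
        \<le> (\<integral>\<^sup>+s. (\<Sum>k\<le>n. ennreal (u k s) * ennreal \<bar>s - x k\<bar>) \<partial>\<nu>)"
      by (rule wasserstein1_le_partition_of_unity)
        (use um eu1 mass sets prob_space_axioms in simp_all)
    also have "\<dots> \<le> (\<integral>\<^sup>+s. ennreal (infdist s X + 3 * \<theta>) \<partial>\<nu>)"
    proof (rule nn_integral_mono_AE)
      show "AE s in \<nu>. (\<Sum>k\<le>n. ennreal (u k s) * ennreal \<bar>s - x k\<bar>) \<le> ennreal (infdist s X + 3 * \<theta>)"
        using competitor_AE[OF comp]
      proof eventually_elim
        case (elim s)
        obtain i where i: "i \<le> n" "s \<in> nearest_cell i" using nearest_cell_partition by blast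
        have "(\<Sum>k\<le>n. u k s * \<bar>s - x k\<bar>)
            = (1 - \<theta>) * (\<Sum>k\<le>n. indicator (nearest_cell k) s * \<bar>s - x k\<bar>)
              + (\<Sum>k\<le>n. g k * \<bar>s - x k\<bar>)"
          unfolding u_def sum_distrib_left sum.distrib[symmetric]
          by (intro sum.cong refl) (simp only: distrib_right mult.assoc)
        also have "(\<Sum>k\<le>n. indicator (nearest_cell k) s * \<bar>s - x k\<bar>) = infdist s X"
          using one[OF i, of "\<lambda>k. \<bar>s - x k\<bar>"] i by (simp add: nearest_cell_def)
        \<comment> \<open>The spread mass has total \<theta>, and no move inside [-1, 2] is longer
          than 3.\<close>
        also have "(\<Sum>k\<le>n. g k * \<bar>s - x k\<bar>) \<le> (\<Sum>k\<le>n. g k * 3)"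
          using g0 nodes_bounds elim by (intro sum_mono mult_left_mono) (auto simp: abs_le_iff, force+)
        also have "\<dots> = 3 * \<theta>" using sum_g by (simp add: sum_distrib_right[symmetric])
        also have "(1 - \<theta>) * infdist s X \<le> 1 * infdist s X"
          using th by (intro mult_right_mono) (auto simp: infdist_nonneg)
        finally have "(\<Sum>k\<le>n. u k s * \<bar>s - x k\<bar>) \<le> infdist s X + 3 * \<theta>" by simp
        moreover have "(\<Sum>k\<le>n. ennreal (u k s) * ennreal \<bar>s - x k\<bar>)
            = ennreal (\<Sum>k\<le>n. u k s * \<bar>s - x k\<bar>)"
          using u0 by (subst sum_ennreal[symmetric]) (auto simp: ennreal_mult)
        ultimately show ?case by (simp add: ennreal_leI)
      qed
    qed
    also have "\<dots> = ennreal (\<integral>s. infdist s X + 3 * \<theta> \<partial>\<nu>)"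
      using competitor_integrable_infdist[OF comp] th
      by (intro nn_integral_eq_integral) (auto simp: infdist_nonneg)
    also have "\<dots> = ennreal ((\<integral>s. infdist s X \<partial>\<nu>) + 3 * \<theta>)"
      using competitor_integrable_infdist[OF comp] by (simp add: prob_space)
    also have "\<dots> \<le> ennreal ((A + 3 * B) * sqrt (\<alpha> - x n))"
      using first[OF comp] by (intro ennreal_leI) (simp add: \<theta>_def algebra_simps)
    finally show ?thesis .
  qed
  moreover have "0 < (1 / B)\<^sup>2" "0 < A + 3 * B" using A B by simp_all
  ultimately show ?thesis by blast
qed

text \<open>The basis polynomials stay at the original nodes; only the cells move. Replacing
  \<open>x n\<close> by \<open>\<alpha>\<close> displaces a node by at most
  \<open>\<alpha> - x n\<close>. This is paid twice, at the assigned node and at the nearest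
  original one, which gives the \<open>2 * \<delta>\<close> added to \<open>infdist s X\<close>.
  Ties may be broken by \<open>\<pi>\<close> in any measurable way.\<close>

lemma moved_cell_bound:
  "\<exists>C>0. \<forall>\<nu> \<alpha> \<pi>. competitor \<nu> \<alpha> \<longrightarrow> nearest_projection {-1..\<alpha>} (x(n := \<alpha>) ` {..n}) \<pi> \<longrightarrow>
     (\<Sum>k\<le>n. \<bar>measure \<nu> {s \<in> {-1..\<alpha>}. \<pi> s = (x(n := \<alpha>)) k} - l k\<bar>) \<le> C * sqrt (\<alpha> - x n)"
proof -
  obtain A where A: "0 < A"
    and first: "\<And>\<nu> \<alpha>. competitor \<nu> \<alpha> \<Longrightarrow> (\<integral>s. infdist s X \<partial>\<nu>) \<le> A * sqrt (\<alpha> - x n)"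
    using first_moment_bound by blast
  obtain K where K: "0 < K"
    and cells: "\<And>\<nu> \<alpha> E D. competitor \<nu> \<alpha> \<Longrightarrow> (\<And>k. k \<le> n \<Longrightarrow> E k \<in> sets borel) \<Longrightarrow> integrable \<nu> D \<Longrightarrow>
     (AE s in \<nu>. \<exists>k\<le>n. s \<in> E k \<and> \<bar>s - x k\<bar> \<le> D s \<and> (\<forall>j\<le>n. s \<in> E j \<longrightarrow> j = k)) \<Longrightarrow>
     (\<Sum>k\<le>n. \<bar>measure \<nu> (E k) - l k\<bar>) \<le> K * (\<integral>s. D s \<partial>\<nu>)"
  proof (rule cell_weight_bound, goal_cases)
    case (1 K)
    show ?case by (rule 1(1)) (fact 1(2), rule 1(3))
  qed
  have "(\<Sum>k\<le>n. \<bar>measure \<nu> {s \<in> {-1..\<alpha>}. \<pi> s = (x(n := \<alpha>)) k} - l k\<bar>)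
      \<le> K * (A + 2) * sqrt (\<alpha> - x n)"
    if comp: "competitor \<nu> \<alpha>" and pr: "nearest_projection {-1..\<alpha>} (x(n := \<alpha>) ` {..n}) \<pi>" for \<nu> \<alpha> \<pi>
  proof -
    interpret prob_space \<nu> using comp by (simp add: competitor_def)
    define \<delta> where "\<delta> = \<alpha> - x n"
    define y where "y = x(n := \<alpha>)"
    define E where "E k = {s \<in> {-1..\<alpha>}. \<pi> s = y k}" for k
    have d: "0 \<le> \<delta>" "\<delta> \<le> 1" using comp by (auto simp: \<delta>_def competitor_def)
    have xy: "\<bar>x k - y k\<bar> \<le> \<delta>" for k using d by (simp add: y_def \<delta>_def)
    \<comment> \<open>Moving the top node upwards keeps the order, so the centres stay distinct and
      the cells cannot overlap.\<close>
    have y_less: "y i < y j" if "i < j" "j \<le> n" for i j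
      using nodes_less[OF that] that d by (auto simp: y_def \<delta>_def)
    then have inj_y: "i = j" if "y i = y j" "i \<le> n" "j \<le> n" for i j
      using that by (metis less_irrefl linorder_neqE_nat)
    have meas: "\<pi> \<in> borel_measurable (restrict_space borel {-1..\<alpha>})"
      and proj: "\<And>s. s \<in> {-1..\<alpha>} \<Longrightarrow> \<pi> s \<in> y ` {..n} \<and> \<bar>s - \<pi> s\<bar> = infdist s (y ` {..n})"
      using pr unfolding nearest_projection_def y_def by (auto simp: dist_real_def)
    have Em: "E k \<in> sets borel" for k
    proof -
      have "\<pi> -` {y k} \<inter> space (restrict_space borel {-1..\<alpha>}) \<in> sets (restrict_space borel {-1..\<alpha>})"
        by (rule measurable_sets[OF meas]) simp
      moreover have "\<pi> -` {y k} \<inter> space (restrict_space borel {-1..\<alpha>}) = E k"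
        by (auto simp: E_def space_restrict_space)
      ultimately show ?thesis by (auto simp: sets_restrict_space)
    qed
    have "(\<Sum>k\<le>n. \<bar>measure \<nu> (E k) - l k\<bar>) \<le> K * (\<integral>s. infdist s X + 2 * \<delta> \<partial>\<nu>)"
    proof (rule cells[OF comp])
      show "E k \<in> sets borel" for k by (rule Em)
      show "integrable \<nu> (\<lambda>s. infdist s X + 2 * \<delta>)"
        using competitor_integrable_infdist[OF comp] by simp
      show "AE s in \<nu>. \<exists>k\<le>n. s \<in> E k \<and> \<bar>s - x k\<bar> \<le> infdist s X + 2 * \<delta>
              \<and> (\<forall>j\<le>n. s \<in> E j \<longrightarrow> j = k)"
        using competitor_AE[OF comp]
      proof eventually_elim
        case (elim s)
        then obtain k where k: "k \<le> n" "\<pi> s = y k" using proj[of s] by auto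
        obtain j where j: "j \<le> n" "infdist s X = \<bar>s - x j\<bar>"
          using infdist_eq_dist_node[where s = s and x = x and n = n] by auto
        have "\<bar>s - y k\<bar> \<le> \<bar>s - y j\<bar>"
          using proj[of s] elim k infdist_le_node[OF j(1), of s y] by auto
        then have "\<bar>s - x k\<bar> \<le> infdist s X + 2 * \<delta>"
          using j xy[of j] xy[of k] by linarith
        moreover have "i = k" if "i \<le> n" "s \<in> E i" for i
          using inj_y[of i k] that k by (simp add: E_def)
        moreover have "s \<in> E k" using k elim by (simp add: E_def)
        ultimately show ?case using k(1) by blast
      qed
    qed
    also have "(\<integral>s. infdist s X + 2 * \<delta> \<partial>\<nu>) = (\<integral>s. infdist s X \<partial>\<nu>) + 2 * \<delta>"
      using competitor_integrable_infdist[OF comp] by (simp add: prob_space)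
    also have "K * \<dots> \<le> K * (A * sqrt \<delta> + 2 * sqrt \<delta>)"
    proof -
      \<comment> \<open>As \<delta> is at most 1, the linear error of the moved node is absorbed by
        the square root.\<close>
      have "\<delta> \<le> sqrt \<delta>" using d by (intro real_le_rsqrt) (simp add: power2_eq_square mult_left_le)
      then show ?thesis using first[OF comp] K by (intro mult_left_mono) (auto simp: \<delta>_def)
    qed
    finally show ?thesis by (simp add: E_def y_def \<delta>_def algebra_simps)
  qed
  moreover have "0 < K * (A + 2)" using K A by simp
  ultimately show ?thesis by blast
qed

section \<open>The three estimates with common constants\<close>

theorem quadrature_stability:
  "\<exists>\<epsilon>0 C. \<epsilon>0 > 0 \<and> C > 0 \<and>
    (\<forall>\<nu> \<alpha>. x n \<le> \<alpha> \<and> \<alpha> \<le> x n + \<epsilon>0 \<and>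
       prob_space \<nu> \<and> sets \<nu> = sets borel \<and> (AE s in \<nu>. s \<in> {-1..\<alpha>}) \<and>
       (\<forall>k\<le>t. (\<integral>s. s ^ k \<partial>\<nu>) = (\<integral>s. s ^ k \<partial>M)) \<longrightarrow>
       (\<integral>s. (infdist s X)\<^sup>2 \<partial>\<nu>) \<le> C * (\<alpha> - x n) \<and>
       wasserstein1 \<nu> (distr (point_measure {..n} (\<lambda>k. ennreal (l k))) borel x)
         \<le> ennreal (C * sqrt (\<alpha> - x n)) \<and>
       (\<forall>\<pi>. nearest_projection {-1..\<alpha>} (x(n := \<alpha>) ` {..n}) \<pi> \<longrightarrow>
          (\<Sum>k\<le>n. \<bar>measure \<nu> {s \<in> {-1..\<alpha>}. \<pi> s = (x(n := \<alpha>)) k} - l k\<bar>)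
            \<le> C * sqrt (\<alpha> - x n)))"
proof -
  obtain C1 where C1: "C1 > 0"
    "\<And>\<nu> \<alpha>. competitor \<nu> \<alpha> \<Longrightarrow> (\<integral>s. (infdist s X)\<^sup>2 \<partial>\<nu>) \<le> C1 * (\<alpha> - x n)"
    using second_moment_bound by blast
  obtain \<epsilon> C2 where C2: "\<epsilon> > 0" "C2 > 0"
    "\<forall>\<nu> \<alpha>. competitor \<nu> \<alpha> \<longrightarrow> \<alpha> - x n \<le> \<epsilon> \<longrightarrow>
       wasserstein1 \<nu> (distr (point_measure {..n} (\<lambda>k. ennreal (l k))) borel x)
         \<le> ennreal (C2 * sqrt (\<alpha> - x n))"
    using wasserstein_bound by (elim exE conjE) (rule that)
  obtain C3 where C3: "C3 > 0"
    "\<forall>\<nu> \<alpha> \<pi>. competitor \<nu> \<alpha> \<longrightarrow> nearest_projection {-1..\<alpha>} (x(n := \<alpha>) ` {..n}) \<pi> \<longrightarrow>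
       (\<Sum>k\<le>n. \<bar>measure \<nu> {s \<in> {-1..\<alpha>}. \<pi> s = (x(n := \<alpha>)) k} - l k\<bar>) \<le> C3 * sqrt (\<alpha> - x n)"
    using moved_cell_bound by (elim exE conjE) (rule that)
  define C where "C = C1 + C2 + C3"
  have le: "C1 \<le> C" "C2 \<le> C" "C3 \<le> C" "0 < C" using C1(1) C2(2) C3(1) by (auto simp: C_def)
  show ?thesis
  \<comment> \<open>The 1 is demanded by \<open>competitor\<close>, the \<epsilon> by the transport
    plan.\<close>
  proof (rule exI[of _ "min 1 \<epsilon>"], rule exI[of _ C], intro conjI allI impI; (elim conjE)?)
    fix \<nu> \<alpha>
    assume *: "x n \<le> \<alpha>" "\<alpha> \<le> x n + min 1 \<epsilon>" "prob_space \<nu>" "sets \<nu> = sets borel"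
      "AE s in \<nu>. s \<in> {-1..\<alpha>}" "\<forall>k\<le>t. (\<integral>s. s ^ k \<partial>\<nu>) = (\<integral>s. s ^ k \<partial>M)"
    then have comp: "competitor \<nu> \<alpha>" by (simp add: competitor_def)
    have d: "0 \<le> \<alpha> - x n" "0 \<le> sqrt (\<alpha> - x n)" "\<alpha> - x n \<le> \<epsilon>" using * by auto
    show "(\<integral>s. (infdist s X)\<^sup>2 \<partial>\<nu>) \<le> C * (\<alpha> - x n)"
      using C1(2)[OF comp] mult_right_mono[OF le(1) d(1)] by linarith
    show "wasserstein1 \<nu> (distr (point_measure {..n} (\<lambda>k. ennreal (l k))) borel x)
         \<le> ennreal (C * sqrt (\<alpha> - x n))"
      using C2(3)[rule_format, OF comp d(3)] ennreal_leI[OF mult_right_mono[OF le(2) d(2)]] by (rule order.trans)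
    fix \<pi> assume "nearest_projection {-1..\<alpha>} (x(n := \<alpha>) ` {..n}) \<pi>"
    then show "(\<Sum>k\<le>n. \<bar>measure \<nu> {s \<in> {-1..\<alpha>}. \<pi> s = (x(n := \<alpha>)) k} - l k\<bar>)
            \<le> C * sqrt (\<alpha> - x n)"
      using C3(2)[rule_format, OF comp] mult_right_mono[OF le(3) d(2)] by (meson order.trans)
  qed (use le(4) C2(1) in auto)
qed

end

section \<open>The sphere marginal\<close>

text \<open>Only d = 2 is singular: there the weight is unbounded, but it has the bounded
  antiderivative \<open>arcsin\<close>. For d at least 3 the exponent is nonnegative and the weight
  is at most 1 on the interval.\<close>

lemma sphere_weight_integrable:
  assumes "d \<ge> 2"
  shows "set_integrable lborel {-1..1} (\<lambda>s::real. (1 - s\<^sup>2) powr ((real d - 3) / 2))"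
proof (cases "d = 2")
  case True
  have 1: "- 1 < s \<Longrightarrow> s < 1 \<Longrightarrow> 0 < 1 - s\<^sup>2" for s :: real
    by (simp add: power2_less_1_iff abs_less_iff)
  have int: "set_integrable lborel (einterval (-1) 1) (\<lambda>s. inverse (sqrt (1 - s\<^sup>2)))"
  proof (rule interval_integral_FTC_nonneg(1))
    show "DERIV arcsin s :> inverse (sqrt (1 - s\<^sup>2))" if "- 1 < ereal s" "ereal s < 1" for s
      using that by (intro DERIV_arcsin) (auto simp: one_ereal_def)
    show "isCont (\<lambda>s. inverse (sqrt (1 - s\<^sup>2))) s" if "- 1 < ereal s" "ereal s < 1" for s
      using that 1[of s] by (intro continuous_intros) (auto simp: one_ereal_def)
    have "(arcsin \<longlongrightarrow> arcsin (-1)) (at_right (-1))"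
      using continuous_on_arcsin'[unfolded continuous_on_def, rule_format, of "-1"]
      by (auto intro: tendsto_within_subset simp: at_within_Icc_at_right)
    then show "((arcsin \<circ> real_of_ereal) \<longlongrightarrow> arcsin (-1)) (at_right (-1))"
      by (simp add: ereal_tendsto_simps one_ereal_def)
    have "(arcsin \<longlongrightarrow> arcsin 1) (at_left 1)"
      using continuous_on_arcsin'[unfolded continuous_on_def, rule_format, of 1]
      by (auto simp: at_within_Icc_at_left)
    then show "((arcsin \<circ> real_of_ereal) \<longlongrightarrow> arcsin 1) (at_left 1)"
      by (simp add: ereal_tendsto_simps one_ereal_def)
  qed (auto intro!: AE_I2 simp: abs_square_le_1 abs_le_iff one_ereal_def)
  \<comment> \<open>Since \<open>0 powr a = 0\<close>, the weight vanishes at the endpoints by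
    convention, so the integrands for the open and the closed interval agree everywhere.\<close>
  have "indicator (einterval (-1) 1) s *\<^sub>R inverse (sqrt (1 - s\<^sup>2))
      = indicator {-1..1} s *\<^sub>R (1 - s\<^sup>2) powr ((real d - 3) / 2)" for s :: real
  proof (cases "- 1 < s \<and> s < 1")
    case True
    then show ?thesis
      using 1[of s] \<open>d = 2\<close>
      by (simp add: indicator_def einterval_def powr_minus powr_half_sqrt one_ereal_def)
  next
    case False
    then have "s \<in> {-1..1} \<Longrightarrow> s = 1 \<or> s = -1" by auto
    then show ?thesis
      using False by (auto simp: indicator_def einterval_def one_ereal_def)
  qed
  then show ?thesis using int by (simp add: set_integrable_def)
next
  case False
  then have d: "d \<ge> 3" using assms by simp
  show ?thesis
    unfolding set_integrable_def
  proof (rule Bochner_Integration.integrable_bound)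
    show "integrable lborel (indicator {-1..1} :: real \<Rightarrow> real)"
      by (simp add: integrable_indicator_iff)
    show "AE s::real in lborel. norm (indicator {-1..1} s *\<^sub>R (1 - s\<^sup>2) powr ((real d - 3) / 2))
        \<le> norm (indicator {-1..1} s :: real)"
    proof (intro AE_I2)
      fix s :: real
      have "(1 - s\<^sup>2) powr ((real d - 3) / 2) \<le> 1" if "\<bar>s\<bar> \<le> 1"
      proof -
        have "s\<^sup>2 \<le> 1" using that by (simp add: abs_square_le_1)
        then show ?thesis using d by (intro powr_le1) auto
      qed
      then show "norm (indicator {-1..1} s *\<^sub>R (1 - s\<^sup>2) powr ((real d - 3) / 2))
        \<le> norm (indicator {-1..1} s :: real)"
        by (auto simp: indicator_def abs_le_iff)
    qed
  qed measurable
qed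

text \<open>A polynomial vanishing almost everywhere on the interval would have infinitely many zeros.\<close>

lemma integral_poly_weight_pos:
  fixes w :: "real \<Rightarrow> real"
  assumes int: "integrable lborel (\<lambda>s. w s * poly p s)"
    and w0: "\<And>s. 0 \<le> w s" and wpos: "\<And>s. -1 < s \<Longrightarrow> s < 1 \<Longrightarrow> 0 < w s"
    and wsupp: "\<And>s. s \<notin> {-1..1} \<Longrightarrow> w s = 0"
    and p: "p \<noteq> 0" "\<And>s. -1 \<le> s \<Longrightarrow> s \<le> 1 \<Longrightarrow> 0 \<le> poly p s"
  shows "0 < (\<integral>s. w s * poly p s \<partial>lborel)"
proof (rule ccontr)
  have nonneg: "0 \<le> w s * poly p s" for s
    using w0[of s] p(2)[of s] wsupp[of s] by (cases "s \<in> {-1..1}") auto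
  assume "\<not> ?thesis"
  moreover have "0 \<le> (\<integral>s. w s * poly p s \<partial>lborel)" using nonneg by (intro integral_nonneg_AE) auto
  ultimately have "(\<integral>s. w s * poly p s \<partial>lborel) = 0" by simp
  then have "AE s in lborel. w s * poly p s = 0"
    using nonneg int by (subst (asm) integral_nonneg_eq_0_iff_AE) auto
  moreover have "AE s in lborel. s \<notin> {s. poly p s = 0}"
    using poly_roots_finite[OF p(1)]
    by (intro AE_not_in finite_imp_null_set_lborel)
  ultimately have "AE s in lborel. s \<notin> {-1<..<1::real}"
  proof eventually_elim
    case (elim s)
    then show ?case using wpos[of s] by auto
  qed
  then have "{-1<..<1::real} \<in> null_sets lborel" by (subst (asm) AE_iff_null_sets[symmetric]) auto
  then show False by (simp add: null_sets_def)
qed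

text \<open>A divergent integral would count as 0, and so would its inverse, which would make the
  measure null. Integrability and positivity of the weight exclude this.\<close>

lemma sphere_marginal_const_pos:
  assumes "d \<ge> 2"
  shows "0 < sphere_marginal_const d"
proof -
  let ?w = "\<lambda>s::real. indicator {-1..1} s * (1 - s\<^sup>2) powr ((real d - 3) / 2)"
  have "0 < (\<integral>s. ?w s * poly 1 s \<partial>lborel)"
  proof (rule integral_poly_weight_pos)
    show "integrable lborel (\<lambda>s. ?w s * poly 1 s)"
      using sphere_weight_integrable[OF assms] by (simp add: set_integrable_def)
    show "0 < ?w s" if "-1 < s" "s < 1" for s
    proof -
      have "s\<^sup>2 < 1" using that by (simp add: power2_less_1_iff abs_less_iff)
      then show ?thesis using that by simp
    qed
  qed auto
  then show ?thesis
    unfolding sphere_marginal_const_def by (simp add: set_lebesgue_integral_def)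
qed

lemma sets_sphere_marginal [simp, measurable_cong]: "sets (sphere_marginal d) = sets borel"
  by (simp add: sphere_marginal_def)

lemma AE_sphere_marginal: "AE s in sphere_marginal d. s \<in> {-1..1}"
  unfolding sphere_marginal_def by (subst AE_density) (auto simp: indicator_def)

lemma poly_moments_sphere_marginal:
  assumes "d \<ge> 2"
  shows "poly_moments (sphere_marginal d)"
proof -
  define w where "w s = sphere_marginal_const d * (1 - s\<^sup>2) powr ((real d - 3) / 2)
                    * indicator {-1..1} s" for s :: real
  note c = sphere_marginal_const_pos[OF assms]
  have wm: "w \<in> borel_measurable lborel" unfolding w_def by measurable
  have w0: "0 \<le> w s" for s unfolding w_def using c by simp
  have M: "sphere_marginal d = density lborel (\<lambda>s. ennreal (w s))"
    unfolding sphere_marginal_def w_def ..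
  have wi: "integrable lborel w"
    using sphere_weight_integrable[OF assms]
      integrable_mult_right[of "sphere_marginal_const d" lborel
        "\<lambda>s. indicator {-1..1} s * (1 - s\<^sup>2) powr ((real d - 3) / 2)"]
    unfolding w_def[abs_def] set_integrable_def by (simp add: mult_ac)
  have pm: "poly p \<in> borel_measurable lborel" for p :: "real poly"
    using borel_measurable_continuous_onI[of "poly p"] by (simp add: continuous_intros)
  have pi: "integrable lborel (\<lambda>s. w s * poly p s)" for p
  proof -
    have "bounded (poly p ` {-1..1})"
      by (intro compact_imp_bounded compact_continuous_image continuous_intros) simp
    then obtain B where B: "\<And>s. s \<in> {-1..1} \<Longrightarrow> \<bar>poly p s\<bar> \<le> B"
      unfolding bounded_iff by (auto simp del: atLeastAtMost_iff)
    show ?thesis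
    proof (rule Bochner_Integration.integrable_bound)
      show "integrable lborel (\<lambda>s. B * w s)" using wi by simp
      show "AE s in lborel. norm (w s * poly p s) \<le> norm (B * w s)"
      proof (intro AE_I2)
        fix s
        show "norm (w s * poly p s) \<le> norm (B * w s)"
        proof (cases "s \<in> {-1..1}")
          case True
          then have "\<bar>poly p s\<bar> \<le> \<bar>B\<bar>" using B[of s] by linarith
          then show ?thesis
            using mult_right_mono[of "\<bar>poly p s\<bar>" "\<bar>B\<bar>" "w s"] w0[of s]
            by (simp add: abs_mult mult.commute)
        qed (simp add: w_def)
      qed
    qed (use wm pm in simp)
  qed
  have int_eq: "(\<integral>s. poly p s \<partial>sphere_marginal d) = (\<integral>s. w s * poly p s \<partial>lborel)" for p
    unfolding M using wm pm w0 by (subst integral_density) auto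
  show ?thesis
  proof
    show "integrable (sphere_marginal d) (poly p)" for p
      unfolding M using wm pm w0 pi by (subst integrable_density) auto
    fix p :: "real poly"
    assume p: "p \<noteq> 0" "\<And>s. -1 \<le> s \<Longrightarrow> s \<le> 1 \<Longrightarrow> 0 \<le> poly p s"
    show "0 < (\<integral>s. poly p s \<partial>sphere_marginal d)"
      unfolding int_eq
    proof (rule integral_poly_weight_pos[OF pi w0 _ _ p])
      show "0 < w s" if "-1 < s" "s < 1" for s
      proof -
        have "s\<^sup>2 < 1" using that by (simp add: power2_less_1_iff abs_less_iff)
        then show ?thesis using that c by (simp add: w_def)
      qed
    qed (auto simp: w_def)
  qed
qed

section \<open>The measure with the additional weight 1 + s\<close>

context poly_moments
begin

text \<open>The weight is absorbed into the polynomial, so positivity is inherited and orthogonality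
  for the new measure turns into orthogonality for \<open>M\<close>. The support condition ensures
  that \<open>ennreal\<close> truncates \<open>1 + s\<close> only on a null set.\<close>

lemma integral_density_one_plus:
  assumes sets: "sets M = sets borel" and AE: "AE s in M. s \<in> {-1..1}"
  shows "(\<integral>s. poly p s \<partial>density M (\<lambda>s. ennreal (1 + s))) = (\<integral>s. poly ([:1, 1:] * p) s \<partial>M)"
    and "poly_moments (density M (\<lambda>s. ennreal (1 + s)))"
proof -
  have pm: "poly p \<in> borel_measurable M" for p
    using integrable_poly[of p] by (rule borel_measurable_integrable)
  have m1: "(\<lambda>s. 1 + s) \<in> borel_measurable M"
    using pm[of "[:1, 1:]"] by (simp add: cong: measurable_cong)
  have nn: "AE s in M. 0 \<le> 1 + s" using AE by (rule eventually_mono) auto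
  have eq: "(\<integral>s. poly p s \<partial>density M (\<lambda>s. ennreal (1 + s))) = (\<integral>s. poly ([:1, 1:] * p) s \<partial>M)" for p
    unfolding integral_density[OF pm m1 nn]
    by (rule Bochner_Integration.integral_cong) (simp_all add: algebra_simps)
  then show "(\<integral>s. poly p s \<partial>density M (\<lambda>s. ennreal (1 + s))) = (\<integral>s. poly ([:1, 1:] * p) s \<partial>M)" .
  show "poly_moments (density M (\<lambda>s. ennreal (1 + s)))"
  proof
    show "integrable (density M (\<lambda>s. ennreal (1 + s))) (poly p)" for p
      unfolding integrable_density[OF pm m1 nn]
      using integrable_poly[of "[:1, 1:] * p"]
      by (rule Bochner_Integration.integrable_cong[THEN iffD1, rotated 2])
        (simp_all add: algebra_simps)
    fix p :: "real poly"
    assume p: "p \<noteq> 0" "\<And>s. -1 \<le> s \<Longrightarrow> s \<le> 1 \<Longrightarrow> 0 \<le> poly p s"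
    have "0 \<le> poly ([:1, 1:] * p) s" if "-1 \<le> s" "s \<le> 1" for s
      unfolding poly_mult by (rule mult_nonneg_nonneg) (use p(2)[OF that] that in auto)
    moreover have "[:1, 1:] * p \<noteq> 0" using p(1) by (simp del: mult_pCons_left)
    ultimately show "0 < (\<integral>s. poly p s \<partial>density M (\<lambda>s. ennreal (1 + s)))"
      unfolding eq by (intro integral_poly_pos)
  qed
qed

end

section \<open>Gauss and Gauss-Radau rules\<close>

lemma sorted_list_of_set_nodes:
  fixes A :: "'a::linorder set"
  assumes "finite A" "card A = Suc n"
  defines "x \<equiv> \<lambda>k. sorted_list_of_set A ! k"
  shows "\<And>i j. i < j \<Longrightarrow> j \<le> n \<Longrightarrow> x i < x j" "x ` {..n} = A" "Max A = x n"
proof -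
  have len: "length (sorted_list_of_set A) = Suc n" using assms by simp
  show less: "x i < x j" if "i < j" "j \<le> n" for i j
    unfolding x_def using that len
    by (intro sorted_wrt_nth_less[OF strict_sorted_list_of_set]) auto
  have "x ` {..n} = x ` {..<Suc n}" by (simp add: lessThan_Suc_atMost)
  also have "\<dots> = set (sorted_list_of_set A)"
    unfolding x_def using nth_image[of "Suc n" "sorted_list_of_set A"] len
    by (simp add: atLeast0LessThan)
  also have "\<dots> = A" using assms by simp
  finally show im: "x ` {..n} = A" .
  show "Max A = x n"
  proof (rule Max_eqI)
    show "y \<le> x n" if "y \<in> A" for y
      using that less unfolding im[symmetric] by (auto simp: le_less)
  qed (use assms im in auto)
qed

context poly_moments
begin

text \<open>Gauss's argument: divide \<open>q\<close> by the node polynomial. The quotient part is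
  killed by orthogonality, and the remainder, which agrees with \<open>q\<close> at the nodes, is
  its own interpolant. The bound \<open>t - n\<close> covers the Gauss and the Radau case
  together.\<close>

lemma quadrature_exact:
  assumes inj: "inj_on x {..n}" and P: "P = (\<Prod>z\<in>x ` {..n}. [:-z, 1:])"
    and orth: "orthogonal_below P (t - n)" and n: "n < t" and q: "degree q \<le> t"
  shows "(\<Sum>k\<le>n. (\<integral>s. poly (lagrange_basis n x k) s \<partial>M) * poly q (x k)) = (\<integral>s. poly q s \<partial>M)"
proof -
  have degP: "degree P = Suc n"
    unfolding P degree_prod_linear using inj by (simp add: card_image)
  then have P0: "P \<noteq> 0" by auto
  define r where "r = q mod P"
  have qr: "q = q div P * P + r" by (simp add: r_def)
  have dr: "degree r \<le> n"
    using degree_mod_less[OF P0, of q] degP by (auto simp: r_def)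
  \<comment> \<open>\<open>P\<close> has degree n + 1, one more than n, which makes the inequality
    strict; for a zero quotient it is the assumption \<open>n < t\<close>.\<close>
  have dd: "degree (q div P) < t - n"
  proof (cases "q div P = 0")
    case False
    have "degree (q div P * P) \<le> t"
    proof -
      have "q div P * P = q - r" using qr by (simp add: algebra_simps)
      then show ?thesis using q dr n by (auto intro: degree_diff_le)
    qed
    then show ?thesis using False P0 degP by (simp add: degree_mult_eq)
  qed (use n in simp)
  have Px: "poly P (x k) = 0" if "k \<le> n" for k
    using that by (auto simp: P poly_prod intro!: prod_zero)
  have rx: "poly r (x k) = poly q (x k)" if "k \<le> n" for k
    using arg_cong[OF qr, of "\<lambda>p. poly p (x k)"] Px[OF that] by simp
  define u where "u = (\<Sum>k\<le>n. smult (poly q (x k)) (lagrange_basis n x k))"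
  have "degree u \<le> n"
    unfolding u_def using degree_lagrange_basis[of _ n x]
    by (intro degree_sum_le) (auto intro: order.trans[OF degree_smult_le])
  moreover have "poly u (x i) = poly r (x i)" if "i \<le> n" for i
  proof -
    have "poly u (x i) = (\<Sum>k\<le>n. if k = i then poly q (x k) else 0)"
      unfolding u_def poly_sum
      by (intro sum.cong refl) (auto simp: poly_lagrange_basis[OF inj _ that])
    then show ?thesis using that rx by simp
  qed
  ultimately have "u = r"
    using dr inj by (intro poly_eqI_degree[where A = "x ` {..n}"]) (auto simp: card_image)
  have "poly q s = poly P s * poly (q div P) s + poly r s" for s
    using arg_cong[OF qr, of "\<lambda>p. poly p s"] by (simp add: mult.commute)
  then have "(\<integral>s. poly q s \<partial>M) = (\<integral>s. poly P s * poly (q div P) s + poly r s \<partial>M)"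
    by (rule Bochner_Integration.integral_cong[OF refl])
  also have "\<dots> = (\<integral>s. poly P s * poly (q div P) s \<partial>M) + (\<integral>s. poly r s \<partial>M)"
    by (rule Bochner_Integration.integral_add[OF integrable_poly_mult integrable_poly])
  also have "\<dots> = (\<integral>s. poly u s \<partial>M)"
    using orth dd \<open>u = r\<close> by (simp add: orthogonal_below_def)
  also have "\<dots> = (\<Sum>k\<le>n. poly q (x k) * (\<integral>s. poly (lagrange_basis n x k) s \<partial>M))"
    unfolding u_def poly_sum poly_smult
    by (subst Bochner_Integration.integral_sum) (simp_all add: integrable_poly)
  finally show ?thesis by (simp add: mult.commute)
qed

end

text \<open>Testing on the basis polynomials forces each weight up to index n, and the convention of
  value 0 beyond it settles the rest, so the definite description has exactly one solution.\<close>

lemma quad_weight_exact: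
  assumes "d \<ge> 2" "inj_on (node t d) {..t div 2}" "t \<ge> 1"
    and "poly_moments.orthogonal_below (sphere_marginal d)
      (\<Prod>z\<in>node t d ` {..t div 2}. [:-z, 1:]) (t - t div 2)"
    and "degree q \<le> t"
  shows "(\<Sum>k\<le>t div 2. quad_weight t d k * poly q (node t d k)) = (\<integral>s. poly q s \<partial>sphere_marginal d)"
proof -
  interpret poly_moments "sphere_marginal d" by (rule poly_moments_sphere_marginal[OF assms(1)])
  let ?n = "t div 2" and ?x = "node t d"
  let ?Q = "\<lambda>l. (\<forall>k>?n. l k = 0) \<and> (\<forall>q. degree q \<le> t \<longrightarrow>
        (\<Sum>k\<le>?n. l k * poly q (?x k)) = (\<integral>s. poly q s \<partial>sphere_marginal d))"
  define l where "l k = (if k \<le> ?n then \<integral>s. poly (lagrange_basis ?n ?x k) s \<partial>sphere_marginal d else 0)"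
    for k
  have "?n < t" using assms(3) by simp
  then have "?Q l"
    using quadrature_exact[OF assms(2) refl assms(4)] by (simp add: l_def)
  moreover have "l' = l" if l': "?Q l'" for l'
  proof
    fix i
    show "l' i = l i"
    proof (cases "i \<le> ?n")
      case True
      let ?b = "lagrange_basis ?n ?x i"
      have "(\<Sum>k\<le>?n. l' k * poly ?b (?x k)) = (\<Sum>k\<le>?n. if k = i then l' k else 0)"
        using True by (intro sum.cong refl) (auto simp: poly_lagrange_basis[OF assms(2)])
      moreover have "degree ?b \<le> t"
        using degree_lagrange_basis[OF True, of ?x] by simp
      ultimately show ?thesis using l' True by (simp add: l_def)
    qed (use l' in \<open>simp add: l_def\<close>)
  qed
  ultimately have "?Q (quad_weight t d)"
    unfolding quad_weight_def by (rule theI)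
  then show ?thesis using assms(5) by blast
qed

text \<open>For even \<open>t\<close> the node polynomial is 1 + s times the polynomial orthogonal
  for the weight 1 + s. The extra factor converts the weighted integral into one over the sphere
  marginal, and the degree bound n equals t - n.\<close>

lemma node_set_facts:
  assumes "d \<ge> 2" "t \<ge> 2"
  shows "finite (node_set t d)" "card (node_set t d) = Suc (t div 2)"
    and "node_set t d \<subseteq> {-1..<1}" "even t \<Longrightarrow> -1 \<in> node_set t d"
    and "eta t d = Max (node_set t d)"
    and "poly_moments.orthogonal_below (sphere_marginal d)
      (\<Prod>z\<in>node_set t d. [:-z, 1:]) (t - t div 2)"
proof -
  interpret M: poly_moments "sphere_marginal d" by (rule poly_moments_sphere_marginal[OF assms(1)])
  let ?N = "density (sphere_marginal d) (\<lambda>s. ennreal (1 + s))"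
  note dens = M.integral_density_one_plus[OF sets_sphere_marginal AE_sphere_marginal]
  interpret N: poly_moments ?N by (rule dens(2))
  let ?n = "t div 2"
  have "finite (node_set t d) \<and> card (node_set t d) = Suc ?n \<and> node_set t d \<subseteq> {-1..<1} \<and>
    (even t \<longrightarrow> -1 \<in> node_set t d) \<and> eta t d = Max (node_set t d) \<and>
    M.orthogonal_below (\<Prod>z\<in>node_set t d. [:-z, 1:]) (t - ?n)"
  proof (cases "odd t")
    case True
    let ?p = "orth_poly (sphere_marginal d) (?n + 1)"
    note z = M.orthogonal_zeros[OF M.degree_orth_poly M.lead_coeff_orth_poly
        M.orthogonal_orth_poly, of "?n + 1"]
    have ns: "node_set t d = {z. poly ?p z = 0}"
      using True by (simp add: node_set_def quad_zeros_def)
    have "t - ?n = ?n + 1" using True by presburger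
    then have "M.orthogonal_below (\<Prod>z\<in>node_set t d. [:-z, 1:]) (t - ?n)"
      using M.orthogonal_orth_poly[of "?n + 1"] z(4) unfolding ns by simp
    moreover have "eta t d = Max (node_set t d)"
      using True by (simp add: eta_def node_set_def)
    ultimately show ?thesis using z(1-3) True unfolding ns by auto
  next
    case False
    let ?p = "orth_poly ?N ?n" and ?Z = "quad_zeros t d"
    note z = N.orthogonal_zeros[OF N.degree_orth_poly N.lead_coeff_orth_poly
        N.orthogonal_orth_poly, of ?n]
    have Z: "?Z = {z. poly ?p z = 0}" and ns: "node_set t d = insert (-1) ?Z"
      using False by (simp_all add: node_set_def quad_zeros_def)
    have fin: "finite ?Z" and card: "card ?Z = ?n" and sub: "?Z \<subseteq> {-1<..<1}"
      and p: "?p = (\<Prod>z\<in>?Z. [:-z, 1:])"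
      using z unfolding Z by blast+
    have notin: "-1 \<notin> ?Z" using sub by auto
    have ne: "?Z \<noteq> {}" using card assms(2) by auto
    \<comment> \<open>The definition of \<open>eta\<close> leaves out the node -1. The maximum is
      unaffected because \<open>t \<ge> 2\<close> provides at least one zero, and zeros lie strictly
      above -1.\<close>
    have "Max (node_set t d) = Max ?Z"
    proof -
      have "-1 < Max ?Z" using Max_in[OF fin ne] sub by auto
      then show ?thesis unfolding ns using fin ne by simp
    qed
    moreover have "M.orthogonal_below (\<Prod>z\<in>node_set t d. [:-z, 1:]) (t - ?n)"
      unfolding M.orthogonal_below_def
    proof (intro allI impI)
      fix q :: "real poly" assume q: "degree q < t - ?n"
      have "t - ?n = ?n" using False by presburger
      then have "0 = (\<integral>s. poly (?p * q) s \<partial>?N)"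
        using N.orthogonal_orth_poly[of ?n] q by (simp add: N.orthogonal_below_def)
      also have "\<dots> = (\<integral>s. poly ([:1, 1:] * (?p * q)) s \<partial>sphere_marginal d)"
        by (rule dens(1))
      also have "[:1, 1:] * (?p * q) = (\<Prod>z\<in>node_set t d. [:-z, 1:]) * q"
        unfolding ns prod.insert[OF fin notin] p[symmetric] by (simp only: minus_minus mult.assoc)
      finally show "(\<integral>s. poly (\<Prod>z\<in>node_set t d. [:-z, 1:]) s * poly q s \<partial>sphere_marginal d) = 0"
        by simp
    qed
    ultimately show ?thesis
      using fin card sub notin False unfolding ns by (auto simp: eta_def)
  qed
  then show "finite (node_set t d)" "card (node_set t d) = Suc (t div 2)"
    "node_set t d \<subseteq> {-1..<1}" "even t \<Longrightarrow> -1 \<in> node_set t d"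
    "eta t d = Max (node_set t d)"
    "M.orthogonal_below (\<Prod>z\<in>node_set t d. [:-z, 1:]) (t - t div 2)"
    by blast+
qed

text \<open>For even \<open>t\<close> there is no room for a double zero at \<open>-1\<close>, but the simple factor \<open>1 + s\<close> is
  already nonnegative on the support.\<close>

lemma exists_node_majorant:
  fixes x :: "nat \<Rightarrow> real"
  assumes "t \<ge> 2" "even t \<Longrightarrow> x 0 = -1"
  shows "\<exists>h. degree h < t \<and> (\<forall>k<t div 2. poly h (x k) = 0) \<and>
    (\<exists>c>0. \<forall>s\<in>{-1..2}. c * (\<Prod>k<t div 2. (s - x k)\<^sup>2) \<le> poly h s)"
proof -
  let ?n = "t div 2"
  have deg: "degree (\<Prod>k\<in>A. [:-x k, 1:]\<^sup>2) \<le> 2 * card A" if "finite A" for A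
  proof -
    have "degree (\<Prod>k\<in>A. [:-x k, 1:]\<^sup>2) \<le> (\<Sum>k\<in>A. degree ([:-x k, 1:]\<^sup>2))"
      using degree_prod_sum_le[OF that, of "\<lambda>k. [:-x k, 1:]\<^sup>2"] by (simp only: o_def)
    also have "\<dots> \<le> (\<Sum>k\<in>A. 2)"
      by (intro sum_mono order.trans[OF degree_power_le]) simp
    finally show ?thesis by simp
  qed
  have ev: "poly (\<Prod>k\<in>A. [:-x k, 1:]\<^sup>2) s = (\<Prod>k\<in>A. (s - x k)\<^sup>2)" for A s
    by (simp only: poly_prod poly_power) simp
  show ?thesis
  proof (cases "odd t")
    case True
    have "2 * ?n < t" using True by presburger
    then have "degree (\<Prod>k<?n. [:-x k, 1:]\<^sup>2) < t" using deg[of "{..<?n}"] by simp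
    then show ?thesis
      by (intro exI[of _ "\<Prod>k<?n. [:-x k, 1:]\<^sup>2"] conjI)
        (simp_all only: ev, auto intro!: prod_zero exI[of _ 1])
  next
    case False
    define g where "g = (\<Prod>k\<in>{1..<?n}. [:-x k, 1:]\<^sup>2)"
    have n: "0 < ?n" using assms by simp
    have split: "{..<?n} = insert 0 {1..<?n}" using n by auto
    have "degree ([:1, 1:] * g) \<le> 1 + 2 * (?n - 1)"
      using deg[of "{1..<?n}"] unfolding g_def
      by (intro order.trans[OF degree_mult_le] add_mono) simp_all
    also have "\<dots> < t" using False n by presburger
    finally have d: "degree ([:1, 1:] * g) < t" .
    have z: "poly ([:1, 1:] * g) (x k) = 0" if "k < ?n" for k
    proof (cases "k = 0")
      case True
      then show ?thesis using assms(2) False by simp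
    next
      case k: False
      have "poly g (x k) = 0"
        unfolding g_def ev using k that by (intro prod_zero) auto
      then show ?thesis by simp
    qed
    have l: "1 / 3 * (\<Prod>k<?n. (s - x k)\<^sup>2) \<le> poly ([:1, 1:] * g) s" if "s \<in> {-1..2}" for s
    proof -
      have gs: "poly g s = (\<Prod>k\<in>{1..<?n}. (s - x k)\<^sup>2)" unfolding g_def ev ..
      then have g0: "0 \<le> poly g s" by (simp add: prod_nonneg)
      have "(\<Prod>k<?n. (s - x k)\<^sup>2) = (s + 1)\<^sup>2 * poly g s"
        unfolding split gs using assms(2) False by simp
      \<comment> \<open>On [-1, 2] the simple factor lies between 0 and 3, which is the origin of 1
        / 3.\<close>
      moreover have "1 / 3 * (s + 1)\<^sup>2 \<le> s + 1"
        using mult_left_mono[of "s + 1" 3 "s + 1"] that by (simp add: power2_eq_square)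
      ultimately show ?thesis
        using mult_right_mono[of "1 / 3 * (s + 1)\<^sup>2" "s + 1" "poly g s"] g0
        by (simp add: algebra_simps)
    qed
    show ?thesis
      using d z l by (intro exI[of _ "[:1, 1:] * g"] conjI)
        (blast, blast, rule exI[of _ "1 / 3"], simp)
  qed
qed

theorem theorem7p2:
  fixes d t :: nat
  assumes "d \<ge> 2" and "t \<ge> 2"
  shows "\<exists>\<epsilon>0 C :: real. \<epsilon>0 > 0 \<and> C > 0 \<and>
    (\<forall>(\<nu> :: real measure) \<alpha> :: real.
       eta t d \<le> \<alpha> \<and> \<alpha> \<le> eta t d + \<epsilon>0 \<and>
       prob_space \<nu> \<and> sets \<nu> = sets borel \<and> (AE s in \<nu>. s \<in> {-1..\<alpha>}) \<and>
       (\<forall>k\<le>t. (\<integral>s. s ^ k \<partial>\<nu>) = (\<integral>s. s ^ k \<partial>sphere_marginal d)) \<longrightarrow>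
       (\<integral>s. (infdist s (node_set t d))\<^sup>2 \<partial>\<nu>) \<le> C * (\<alpha> - eta t d) \<and>
       wasserstein1 \<nu> (quad_measure t d) \<le> ennreal (C * sqrt (\<alpha> - eta t d)) \<and>
       (\<forall>\<pi>. nearest_projection {-1..\<alpha>} (moved_node_set t d \<alpha>) \<pi> \<longrightarrow>
          (\<Sum>k\<le>t div 2. \<bar>measure \<nu> (voronoi_cell t d \<alpha> \<pi> k) - quad_weight t d k\<bar>)
            \<le> C * sqrt (\<alpha> - eta t d)))"
proof -
  note ns = node_set_facts[OF assms]
  note nodes = sorted_list_of_set_nodes[OF ns(1,2), folded node_def]
  have inj: "inj_on (node t d) {..t div 2}"
    by (rule inj_onI) (metis atMost_iff less_irrefl nodes(1) linorder_neqE_nat)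
  \<comment> \<open>No node lies below -1, so -1 can only come first in the increasing
    order.\<close>
  have node0: "node t d 0 = -1" if "even t"
  proof -
    have "-1 \<in> node t d ` {..t div 2}" using ns(4)[OF that] nodes(2) by simp
    then obtain j where j: "j \<le> t div 2" "node t d j = -1" by auto
    have "node t d 0 \<in> node_set t d" using nodes(2) by blast
    then have "-1 \<le> node t d 0" using ns(3) by auto
    then show ?thesis using nodes(1)[of 0 j] j by (cases "j = 0") auto
  qed
  obtain h where h: "degree h < t" "\<And>k. k < t div 2 \<Longrightarrow> poly h (node t d k) = 0"
    "\<exists>c>0. \<forall>s\<in>{-1..2}. c * (\<Prod>k<t div 2. (s - node t d k)\<^sup>2) \<le> poly h s"
    using exists_node_majorant[of t "node t d"] assms(2) node0 by blast
  interpret poly_moments "sphere_marginal d" by (rule poly_moments_sphere_marginal[OF assms(1)])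
  interpret quadrature "sphere_marginal d" "t div 2" t "node t d" "quad_weight t d" h
  proof
    show "node t d k \<in> {-1..1}" if "k \<le> t div 2" for k
      using that nodes(2) ns(3) by fastforce
    show "(\<Sum>k\<le>t div 2. quad_weight t d k * poly q (node t d k)) = (\<integral>s. poly q s \<partial>sphere_marginal d)"
      if "degree q \<le> t" for q
      using ns(6) assms that by (intro quad_weight_exact inj) (simp_all add: nodes(2))
  qed (use nodes(1) h in auto)
  \<comment> \<open>The last node is the maximum of the node set, hence \<open>eta t d\<close>; with
    this identification the abstract statement unfolds to the claim.\<close>
  show ?thesis
    using quadrature_stability
    unfolding nodes(2) ns(5) nodes(3) quad_measure_def moved_node_set_def moved_node_def
      voronoi_cell_def .
qed

end
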